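(* Let $(U,\Theta)$ be a random vector taking values in $[0,1]\times S_X$ with probability distribution $p_{U,\Theta}(du\,d\theta)=p(du|\theta)\,p_\Theta(d\theta)$. Assume $\mathbb P[U=0]<1$ and $\mathbb P[U=1]<1$. Consider the problem (P): maximize $\Lambda(g)=\frac{1}{\mathbb E[U]}\mathbb E[U\wedge (1-U)g(\Theta)]$ over all $g\in D(\mathbb E[U])$, where $D(c)=\{g:S_X\to[0,\infty)\text{ Borel measurable}:\ \mathbb E[(1-U)g(\Theta)]=c\}$. (i) If $U=u(\Theta)$ almost surely for some Borel function $u(\cdot)$, then $$g^{(\mathrm{opt})}(\theta):=\frac{\mathbb E[U]}{\mathbb E[U\cdot 1\{U<1\}]}\cdot\frac{u(\theta)}{1-u(\theta)}\,1\{u(\theta)<1\}$$ is a solution to (P) and $$\Lambda(g^{(\mathrm{opt})})=\frac{\mathbb E[U\cdot 1\{U<1\}]}{\mathbb E[U]}=1-\frac{\mathbb P[U=1]}{\mathbb E[U]}.\qquad( * )$$ In the next two cases, suppose that $U$ is not a deterministic function of $\Theta$ (i.e., there is no Borel $u$ with $U=u(\Theta)$ a.s.). (ii) If $\mathbb E[U]<C(g_1)$, then there exist $\alpha\in[0,1)$ and $\lambda\in[0,1]$ such that for $g^{(\mathrm{opt})}:=g_\alpha^{(\lambda)}$ we have $\mathbb E[U]=C(g^{(\mathrm{opt})})$ and $g^{(\mathrm{opt})}$ is a solution to (P). (iii) If $C(g_1)\le \mathbb E[U]$, then $\theta\mapsto g^{(\mathrm{opt})}(\theta):=(\mathbb E[U]/C(g_1))\cdot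 g_1(\theta)$ is a solution to (P) and $\Lambda(g^{(\mathrm{opt})})$ is given by $( * )$.
   Context: $\tau_X:\mathbb R^d\to[0,\infty)$ is a continuous $1$-homogeneous function ($\tau_X(cx)=c\tau_X(x)$ for $c\ge0$) and $S_X=\{x\in\mathbb R^d:\tau_X(x)=1\}$. $p(du|\theta)$ is a regular conditional distribution of $U$ given $\Theta=\theta$ and $p_\Theta$ is the law of $\Theta$. Define $$b(\theta)=\int_{[0,1]}(1-u)\,p(du|\theta),\qquad C(h)=\mathbb E[(1-U)|h(\Theta)|]=\int_{S_X}|h(\theta)|\,b(\theta)\,p_\Theta(d\theta)\in[0,\infty],$$ $$F_\theta(t)=\frac1{b(\theta)}\int_{\{0\le u\le t\}}(1-u)\,p(du|\theta),\quad t\in[0,1]$$ (with $F_\theta(t)=0$ for $t<0$, $F_\theta(t)=1$ for $t\geq 1$). $F_\theta$ is considered for $\theta$ with $b(\theta)>0$; the set $\{b=0\}$ is null for $b(\theta)p_\Theta(d\theta)$ and the values there of the functions below are irrelevant. For $\alpha\in[0,1]$ set $$q_\alpha(\theta)=\inf\{t\ge0:F_\theta(t)\ge\alpha\},\qquad q_{\alpha+}(\theta)=\inf\{t\ge0:F_\theta(t)>\alpha\},$$ with the convention $q_{1+}(\theta)=q_1(\theta)$. For $\lambda\in[0,1]$ let $$q_\alpha^{(\lambda)}(\theta)=(1-\lambda)q_\alpha(\theta)+\lambda q_{\alpha+}(\theta),\qquad g_\alpha^{(\lambda)}(\theta)=\frac{q_\alpha^{(\lambda)}(\theta)}{1-q_\alpha^{(\lambda)}(\theta)},\qquad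 g_\alpha=g_\alpha^{(0)}=\frac{q_\alpha}{1-q_\alpha},$$ where $g_1(\theta)=\infty$ by convention if $q_1(\theta)=1$ (so $C(g_1)$ may be $+\infty$). A "solution to (P)" is an element of $D(\mathbb E[U])$ attaining the maximum.
   Formalization: Assumes E[U·1{U<1}]≠0 in (i) and C(g_1)≠0 in (iii): if U∈{0,1} a.s. the displayed quotients divide by 0. Also u takes values in [0,1], so that g^(opt)≥0, and in (iii) g^(opt) is set to 0 where g_1=∞, since D contains only finite functions. *)

theory Defs
  imports "HOL-Probability.Probability"
begin

definition unit_sphere :: "('a \<Rightarrow> real) \<Rightarrow> 'a set" where
  "unit_sphere \<tau> = {x. \<tau> x = 1}"

text \<open>\<open>\<kappa>\<close> is a regular conditional distribution of the \<open>A\<close>-valued random variable \<open>X\<close> given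
  the \<open>B\<close>-valued random variable \<open>Y\<close>: a probability kernel from \<open>B\<close> to \<open>A\<close> which,
  together with the law of \<open>Y\<close>, determines the joint law of \<open>X\<close> and \<open>Y\<close>.\<close>

definition regular_cond_distr ::
  "'w measure \<Rightarrow> ('w \<Rightarrow> 'a) \<Rightarrow> 'a measure \<Rightarrow> ('w \<Rightarrow> 'b) \<Rightarrow> 'b measure \<Rightarrow> ('b \<Rightarrow> 'a measure) \<Rightarrow> bool" where
  "regular_cond_distr M X A Y B \<kappa> \<longleftrightarrow>
     \<kappa> \<in> B \<rightarrow>\<^sub>M prob_algebra A \<and>
     (\<forall>E\<in>sets A. \<forall>G\<in>sets B.
        emeasure M {\<omega> \<in> space M. X \<omega> \<in> E \<and> Y \<omega> \<in> G} =
        (\<integral>\<^sup>+y\<in>G. emeasure (\<kappa> y) E \<partial>distr M B Y))"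

text \<open>In the following, \<open>U\<close> takes values in \<open>[0,1]\<close>, \<open>\<Theta>\<close> takes values in the set \<open>S\<close>, and
  \<open>\<kappa> \<theta>\<close> stands for \<open>p(du|\<theta>)\<close>. Functions on \<open>S\<close> are functions on the ambient type, of
  which only the values on \<open>S\<close> matter.\<close>

text \<open>The expectation in the constraint is an integral in \<open>[0,\<infinity>]\<close>, so that no integrability
  has to be presupposed.\<close>

definition feasible ::
  "'w measure \<Rightarrow> ('w \<Rightarrow> real) \<Rightarrow> ('w \<Rightarrow> 'a::topological_space) \<Rightarrow> 'a set \<Rightarrow> real \<Rightarrow> ('a \<Rightarrow> real) set" where
  "feasible M U \<Theta> S c =
     {g. g \<in> borel_measurable (restrict_space borel S) \<and> (\<forall>\<theta>\<in>S. 0 \<le> g \<theta>) \<and>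
         (\<integral>\<^sup>+\<omega>. ennreal ((1 - U \<omega>) * g (\<Theta> \<omega>)) \<partial>M) = ennreal c}"

definition Lambda :: "'w measure \<Rightarrow> ('w \<Rightarrow> real) \<Rightarrow> ('w \<Rightarrow> 'a) \<Rightarrow> ('a \<Rightarrow> real) \<Rightarrow> real" where
  "Lambda M U \<Theta> g =
     (1 / (\<integral>\<omega>. U \<omega> \<partial>M)) * (\<integral>\<omega>. min (U \<omega>) ((1 - U \<omega>) * g (\<Theta> \<omega>)) \<partial>M)"

definition is_solution ::
  "'w measure \<Rightarrow> ('w \<Rightarrow> real) \<Rightarrow> ('w \<Rightarrow> 'a::topological_space) \<Rightarrow> 'a set \<Rightarrow> ('a \<Rightarrow> real) \<Rightarrow> bool" where
  "is_solution M U \<Theta> S g \<longleftrightarrow>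
     g \<in> feasible M U \<Theta> S (\<integral>\<omega>. U \<omega> \<partial>M) \<and>
     (\<forall>g'\<in>feasible M U \<Theta> S (\<integral>\<omega>. U \<omega> \<partial>M). Lambda M U \<Theta> g' \<le> Lambda M U \<Theta> g)"

definition deterministic_version ::
  "'w measure \<Rightarrow> ('w \<Rightarrow> real) \<Rightarrow> ('w \<Rightarrow> 'a::topological_space) \<Rightarrow> 'a set \<Rightarrow> ('a \<Rightarrow> real) \<Rightarrow> bool" where
  "deterministic_version M U \<Theta> S u \<longleftrightarrow>
     u \<in> borel_measurable (restrict_space borel S) \<and> (\<forall>\<theta>\<in>S. u \<theta> \<in> {0..1}) \<and>
     (AE \<omega> in M. U \<omega> = u (\<Theta> \<omega>))"

definition C_fun :: "'w measure \<Rightarrow> ('w \<Rightarrow> real) \<Rightarrow> ('w \<Rightarrow> 'a) \<Rightarrow> ('a \<Rightarrow> ereal) \<Rightarrow> ennreal" where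
  "C_fun M U \<Theta> h = (\<integral>\<^sup>+\<omega>. ennreal (1 - U \<omega>) * e2ennreal \<bar>h (\<Theta> \<omega>)\<bar> \<partial>M)"

definition b_fun :: "('a \<Rightarrow> real measure) \<Rightarrow> 'a \<Rightarrow> real" where
  "b_fun \<kappa> \<theta> = (\<integral>u. (1 - u) \<partial>\<kappa> \<theta>)"

text \<open>Where \<open>b_fun \<kappa> \<theta> = 0\<close>, division by zero makes this the distribution function of the
  point mass at \<open>1\<close>; the values at such \<open>\<theta>\<close> are irrelevant.\<close>

definition F_fun :: "('a \<Rightarrow> real measure) \<Rightarrow> 'a \<Rightarrow> real \<Rightarrow> real" where
  "F_fun \<kappa> \<theta> t =
     (if t < 0 then 0 else if 1 \<le> t then 1
      else (1 / b_fun \<kappa> \<theta>) * (LINT u:{0..t}|\<kappa> \<theta>. (1 - u)))"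

definition q_fun :: "('a \<Rightarrow> real measure) \<Rightarrow> real \<Rightarrow> 'a \<Rightarrow> real" where
  "q_fun \<kappa> \<alpha> \<theta> = Inf {t. 0 \<le> t \<and> \<alpha> \<le> F_fun \<kappa> \<theta> t}"

definition q_plus :: "('a \<Rightarrow> real measure) \<Rightarrow> real \<Rightarrow> 'a \<Rightarrow> real" where
  "q_plus \<kappa> \<alpha> \<theta> =
     (if \<alpha> = 1 then q_fun \<kappa> 1 \<theta> else Inf {t. 0 \<le> t \<and> \<alpha> < F_fun \<kappa> \<theta> t})"

definition q_mix :: "('a \<Rightarrow> real measure) \<Rightarrow> real \<Rightarrow> real \<Rightarrow> 'a \<Rightarrow> real" where
  "q_mix \<kappa> \<alpha> l \<theta> = (1 - l) * q_fun \<kappa> \<alpha> \<theta> + l * q_plus \<kappa> \<alpha> \<theta>"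

text \<open>For \<open>\<alpha> < 1\<close> and \<open>b_fun \<kappa> \<theta> > 0\<close> the denominator below is positive. The case \<open>\<alpha> = 1\<close>,
  where the value \<open>\<infinity>\<close> is possible, is treated by \<open>g_one\<close>.\<close>

definition g_mix :: "('a \<Rightarrow> real measure) \<Rightarrow> real \<Rightarrow> real \<Rightarrow> 'a \<Rightarrow> real" where
  "g_mix \<kappa> \<alpha> l \<theta> = q_mix \<kappa> \<alpha> l \<theta> / (1 - q_mix \<kappa> \<alpha> l \<theta>)"

definition g_one :: "('a \<Rightarrow> real measure) \<Rightarrow> 'a \<Rightarrow> ereal" where
  "g_one \<kappa> \<theta> =
     (if q_fun \<kappa> 1 \<theta> = 1 then \<infinity> else ereal (q_fun \<kappa> 1 \<theta> / (1 - q_fun \<kappa> 1 \<theta>)))"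

end

(*
The constraint fixes E[(1-U) g(Theta)], so (P) decouples over theta up to a Lagrange multiplier. Given
Theta = theta, x \<mapsto> E[min U ((1-U) x)] is concave, and with q = x/(1+x) its one-sided derivatives
are the integrals of 1-u over {u \<ge> q} and {u > q}. These enclose (1-\<alpha>) b(theta)
exactly when q lies between q_\<alpha>(theta) and q_{\<alpha>+}(theta), so g_\<alpha>^(l) maximizes
the Lagrangian with multiplier 1-\<alpha>, pointwise in theta. The tail bound
b q/(1-q) \<le> 1/(1-\<alpha>) for q \<le> q_{\<alpha>+} provides the domination needed to reach the level
E[U]: take for \<alpha> the largest value with C(g_\<alpha>) \<le> E[U] and apply the intermediate
value theorem in l. In the other cases the candidate satisfies U \<le> (1-U) g(Theta) almost surely
on {U < 1}, so the reward attains its trivial upper bound U 1{U < 1}.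
*)
theory Submission
  imports Defs
begin

text \<open>The unknown is parametrised by q = x/(1+x) because the two branches of min(u, (1-u) x)
  cross at u = q; optimality then speaks about quantiles of the measure (1-u) p(du|theta). Two
  obstacles shape the argument. The level \<alpha> \<mapsto> C(g_\<alpha>) is only left continuous:
  a flat piece of F_theta lets q_\<alpha> jump to q_{\<alpha>+}, and E[U] may fall into the
  resulting gap, which only the interpolation in l can fill. Moreover the bound on b q/(1-q)
  degenerates as \<alpha> tends to 1, where the mean may be infinite. Limits from the left are
  therefore taken by Fatou in [0,infinity], which is why \<open>odds\<close> has the value top at 1;
  limits from the right are taken by domination at a level bounded away from 1. Points with b(theta)
  = 0 need extra care throughout: F is there the point mass at 1 and the quotients
  degenerate.\<close>

definition odds :: "real \<Rightarrow> ennreal" where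
  "odds q = (if q = 1 then top else ennreal (q / (1 - q)))"

lemma odds_measurable [measurable]: "odds \<in> borel_measurable borel"
  unfolding odds_def by measurable

text \<open>The bound \<open>a n \<le> 1\<close> is what gives continuity at q = 1: from the left
  the quotient explodes to the value top assigned there, whereas beyond 1 it is negative and
  \<open>ennreal\<close> would cut it to 0.\<close>

lemma odds_tendsto:
  assumes a: "\<And>n. a n \<le> 1" and q: "q \<le> 1" and lim: "a \<longlonglongrightarrow> q"
  shows "(\<lambda>n. odds (a n)) \<longlonglongrightarrow> odds q"
proof (cases "q = 1")
  case False
  then have "q < 1" using q by simp
  then have "(\<lambda>n. ennreal (a n / (1 - a n))) \<longlonglongrightarrow> ennreal (q / (1 - q))"
    using lim by (intro tendsto_ennrealI tendsto_intros) auto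
  moreover have "\<forall>\<^sub>F n in sequentially. a n < 1" using lim \<open>q < 1\<close> by (rule order_tendstoD)
  then have "\<forall>\<^sub>F n in sequentially. odds (a n) = ennreal (a n / (1 - a n))"
    by eventually_elim (simp add: odds_def)
  ultimately show ?thesis using False tendsto_cong by (fastforce simp: odds_def)
next
  case True
  have "\<forall>\<^sub>F n in sequentially. ennreal l < odds (a n)" if l: "0 \<le> l" for l
  proof -
    \<comment> \<open>\<open>l / (1 + l)\<close> is the point at which x/(1-x) takes the value
      l.\<close>
    have "l / (1 + l) < q" using l True by (simp add: field_simps)
    with lim have "\<forall>\<^sub>F n in sequentially. l / (1 + l) < a n" by (rule order_tendstoD)
    then show ?thesis
    proof eventually_elim
      case (elim n)
      show ?case
      proof (cases "a n = 1")
        case False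
        then have "a n < 1" using a[of n] by simp
        then have "l < a n / (1 - a n)" using elim l by (simp add: field_simps)
        then show ?thesis using False l by (simp add: odds_def ennreal_less_iff)
      qed (simp add: odds_def)
    qed
  qed
  then show ?thesis using True by (simp add: odds_def tendsto_top_iff_ennreal)
qed

section \<open>Kernels on [0,1] attached to the pair (U, Theta)\<close>

locale cond_law = prob_space M for M :: "'w measure" +
  fixes U :: "'w \<Rightarrow> real" and \<Theta> :: "'w \<Rightarrow> 'a::topological_space" and S :: "'a set"
    and \<kappa> :: "'a \<Rightarrow> real measure"
  assumes U_meas: "U \<in> M \<rightarrow>\<^sub>M restrict_space borel {0..1}"
    and \<Theta>_meas: "\<Theta> \<in> M \<rightarrow>\<^sub>M restrict_space borel S"
    and cond_distr: "regular_cond_distr M U (restrict_space borel {0..1}) \<Theta> (restrict_space borel S) \<kappa>"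
begin

abbreviation "unit_borel \<equiv> restrict_space (borel :: real measure) {0..1}"
abbreviation "S_borel \<equiv> restrict_space (borel :: 'a measure) S"
abbreviation "law \<equiv> distr M S_borel \<Theta>"

lemma space_unit_borel: "space unit_borel = {0..1}" and space_S_borel: "space S_borel = S"
  by (auto simp: space_restrict_space)

lemma U_bounds: "\<omega> \<in> space M \<Longrightarrow> 0 \<le> U \<omega> \<and> U \<omega> \<le> 1"
  using measurable_space[OF U_meas] by (auto simp: space_unit_borel)

lemma \<Theta>_in: "\<omega> \<in> space M \<Longrightarrow> \<Theta> \<omega> \<in> S"
  using measurable_space[OF \<Theta>_meas] by (auto simp: space_S_borel)

lemma U_borel [measurable]: "U \<in> borel_measurable M"
  using U_meas by (auto simp: measurable_restrict_space2_iff)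

lemma kernel: "\<kappa> \<in> S_borel \<rightarrow>\<^sub>M prob_algebra unit_borel"
  using cond_distr by (simp add: regular_cond_distr_def)

lemma kernel_subprob: "\<kappa> \<in> S_borel \<rightarrow>\<^sub>M subprob_algebra unit_borel"
  using kernel by (rule measurable_prob_algebraD)

lemma prob_kernel: "\<theta> \<in> S \<Longrightarrow> prob_space (\<kappa> \<theta>)"
  using measurable_space[OF kernel] by (auto simp: space_S_borel space_prob_algebra)

lemma sets_kernel: "\<theta> \<in> S \<Longrightarrow> sets (\<kappa> \<theta>) = sets unit_borel"
  using measurable_space[OF kernel] by (auto simp: space_S_borel space_prob_algebra)

lemma space_kernel: "\<theta> \<in> S \<Longrightarrow> space (\<kappa> \<theta>) = {0..1}"
  using sets_eq_imp_space_eq[OF sets_kernel] by (simp add: space_unit_borel)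

lemma measurable_kernel:
  assumes "\<theta> \<in> S" "f \<in> borel_measurable borel" shows "f \<in> borel_measurable (\<kappa> \<theta>)"
  using assms(2) measurable_cong_sets[OF sets_kernel[OF assms(1)] refl]
  by (auto intro: measurable_restrict_space1)

lemma integrable_kernel:
  fixes f :: "real \<Rightarrow> real"
  assumes "\<theta> \<in> S" "f \<in> borel_measurable borel" "\<And>u. 0 \<le> u \<Longrightarrow> u \<le> 1 \<Longrightarrow> \<bar>f u\<bar> \<le> c"
  shows "integrable (\<kappa> \<theta>) f"
proof -
  interpret K: prob_space "\<kappa> \<theta>" by (rule prob_kernel) fact
  show ?thesis
    by (rule K.integrable_const_bound[of _ c])
      (use assms measurable_kernel in \<open>auto simp: space_kernel\<close>)
qed

subsection \<open>Disintegration\<close>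

lemma measurable_Pair_kernel:
  assumes "\<theta> \<in> S" shows "(\<lambda>u. (u, \<theta>)) \<in> \<kappa> \<theta> \<rightarrow>\<^sub>M unit_borel \<Otimes>\<^sub>M S_borel"
proof -
  have "(\<lambda>u. (u, \<theta>)) \<in> unit_borel \<rightarrow>\<^sub>M unit_borel \<Otimes>\<^sub>M S_borel"
    using assms by (intro measurable_Pair2') (simp add: space_S_borel)
  then show ?thesis
    by (simp add: measurable_cong_sets[OF sets_kernel[OF assms] refl])
qed

lemma measurable_joint: "(\<lambda>\<omega>. (U \<omega>, \<Theta> \<omega>)) \<in> M \<rightarrow>\<^sub>M unit_borel \<Otimes>\<^sub>M S_borel"
  using U_meas \<Theta>_meas by (rule measurable_Pair)

lemma measurable_kernel_distr:
  "(\<lambda>\<theta>. distr (\<kappa> \<theta>) (unit_borel \<Otimes>\<^sub>M S_borel) (\<lambda>u. (u, \<theta>))) \<in> law \<rightarrow>\<^sub>M subprob_algebra (unit_borel \<Otimes>\<^sub>M S_borel)"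
proof (rule measurable_distr2[where M = unit_borel])
  show "\<kappa> \<in> law \<rightarrow>\<^sub>M subprob_algebra unit_borel"
    using kernel_subprob by simp
  show "(\<lambda>(\<theta>, u). (u, \<theta>)) \<in> law \<Otimes>\<^sub>M unit_borel \<rightarrow>\<^sub>M unit_borel \<Otimes>\<^sub>M S_borel"
    unfolding split_beta by (intro measurable_Pair measurable_snd measurable_fst'') simp_all
qed

text \<open>The kernel identity is known on rectangles only. These form an intersection-stable
  generator and the total mass is finite, so it extends to all measurable sets. Writing the right
  side as a \<open>bind\<close> makes iterated integrals available through
  \<open>nn_integral_bind\<close>.\<close>

lemma joint_law:
  "distr M (unit_borel \<Otimes>\<^sub>M S_borel) (\<lambda>\<omega>. (U \<omega>, \<Theta> \<omega>)) =
     law \<bind> (\<lambda>\<theta>. distr (\<kappa> \<theta>) (unit_borel \<Otimes>\<^sub>M S_borel) (\<lambda>u. (u, \<theta>)))"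
  (is "?L = ?R")
proof -
  let ?P = "unit_borel \<Otimes>\<^sub>M S_borel"
  have sk: "space law \<noteq> {}"
    using \<Theta>_in not_empty by (auto simp: space_S_borel)
  have k: "(\<lambda>\<theta>. distr (\<kappa> \<theta>) ?P (\<lambda>u. (u, \<theta>))) \<in> law \<rightarrow>\<^sub>M subprob_algebra ?P"
    by (rule measurable_kernel_distr)
  have sR: "sets ?R = sets ?P"
    by (rule sets_bind) (use sk in simp_all)
  let ?E = "{a \<times> b |a b. a \<in> sets unit_borel \<and> b \<in> sets S_borel}"
  let ?T = "space unit_borel \<times> space S_borel"
  show ?thesis
  proof (rule measure_eqI_generator_eq[where E = ?E and \<Omega> = ?T and A = "\<lambda>_. ?T"])
    show "Int_stable ?E" by (rule Int_stable_pair_measure_generator)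
    show "?E \<subseteq> Pow ?T" by (rule pair_measure_closed)
    show "sets ?L = sigma_sets ?T ?E" by (simp add: sets_pair_measure)
    show "sets ?R = sigma_sets ?T ?E" by (simp add: sR sets_pair_measure)
    show "range (\<lambda>_. ?T) \<subseteq> ?E" using sets.top[of unit_borel] sets.top[of S_borel] by blast
    show "(\<Union>i::nat. ?T) = ?T" by auto
    show "emeasure ?L ?T \<noteq> \<infinity>" for i :: nat
    proof -
      interpret D: prob_space ?L
        by (rule prob_space_distr) (rule measurable_joint)
      show ?thesis using D.emeasure_finite by simp
    qed
    fix X assume "X \<in> ?E"
    then obtain a b where X: "X = a \<times> b" and a: "a \<in> sets unit_borel" and b: "b \<in> sets S_borel" by auto
    have XP: "X \<in> sets ?P" unfolding X using a b by (rule pair_measureI)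
    have "emeasure ?L X = emeasure M ((\<lambda>\<omega>. (U \<omega>, \<Theta> \<omega>)) -` X \<inter> space M)"
      using XP measurable_joint by (intro emeasure_distr)
    also have "(\<lambda>\<omega>. (U \<omega>, \<Theta> \<omega>)) -` X \<inter> space M = {\<omega> \<in> space M. U \<omega> \<in> a \<and> \<Theta> \<omega> \<in> b}"
      using X by auto
    also have "emeasure M \<dots> = (\<integral>\<^sup>+\<theta>\<in>b. emeasure (\<kappa> \<theta>) a \<partial>law)"
      using cond_distr a b by (simp add: regular_cond_distr_def)
    also have "\<dots> = (\<integral>\<^sup>+\<theta>. emeasure (distr (\<kappa> \<theta>) ?P (\<lambda>u. (u, \<theta>))) X \<partial>law)"
    proof (rule nn_integral_cong)
      fix \<theta> assume "\<theta> \<in> space law"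
      then have \<theta>: "\<theta> \<in> S" by (simp add: space_S_borel)
      have "emeasure (distr (\<kappa> \<theta>) ?P (\<lambda>u. (u, \<theta>))) X = emeasure (\<kappa> \<theta>) ((\<lambda>u. (u, \<theta>)) -` X \<inter> space (\<kappa> \<theta>))"
        by (rule emeasure_distr[OF measurable_Pair_kernel[OF \<theta>] XP])
      also have "(\<lambda>u. (u, \<theta>)) -` X \<inter> space (\<kappa> \<theta>) = (if \<theta> \<in> b then a else {})"
        using X sets.sets_into_space[OF a] by (auto simp: space_kernel[OF \<theta>] space_unit_borel split: if_splits)
      finally show "emeasure (\<kappa> \<theta>) a * indicator b \<theta> = emeasure (distr (\<kappa> \<theta>) ?P (\<lambda>u. (u, \<theta>))) X"
        by simp
    qed
    also have "\<dots> = emeasure ?R X"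
      by (rule emeasure_bind[OF sk k XP, symmetric])
    finally show "emeasure ?L X = emeasure ?R X" .
  qed
qed

lemma disintegration:
  assumes [measurable]: "f \<in> borel_measurable (unit_borel \<Otimes>\<^sub>M S_borel)"
  shows "(\<integral>\<^sup>+\<omega>. f (U \<omega>, \<Theta> \<omega>) \<partial>M) = (\<integral>\<^sup>+\<theta>. \<integral>\<^sup>+u. f (u, \<theta>) \<partial>\<kappa> \<theta> \<partial>law)"
proof -
  let ?P = "unit_borel \<Otimes>\<^sub>M S_borel"
  have k: "(\<lambda>\<theta>. distr (\<kappa> \<theta>) ?P (\<lambda>u. (u, \<theta>))) \<in> law \<rightarrow>\<^sub>M subprob_algebra ?P"
    by (rule measurable_kernel_distr)
  have "(\<integral>\<^sup>+\<omega>. f (U \<omega>, \<Theta> \<omega>) \<partial>M) = (\<integral>\<^sup>+x. f x \<partial>distr M ?P (\<lambda>\<omega>. (U \<omega>, \<Theta> \<omega>)))"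
    by (rule nn_integral_distr[symmetric]) (use measurable_joint in simp_all)
  also have "\<dots> = (\<integral>\<^sup>+\<theta>. \<integral>\<^sup>+x. f x \<partial>distr (\<kappa> \<theta>) ?P (\<lambda>u. (u, \<theta>)) \<partial>law)"
    unfolding joint_law by (rule nn_integral_bind[OF assms k])
  also have "\<dots> = (\<integral>\<^sup>+\<theta>. \<integral>\<^sup>+u. f (u, \<theta>) \<partial>\<kappa> \<theta> \<partial>law)"
  proof (rule nn_integral_cong)
    fix \<theta> assume "\<theta> \<in> space law"
    then have \<theta>: "\<theta> \<in> S" by (simp add: space_S_borel)
    show "(\<integral>\<^sup>+x. f x \<partial>distr (\<kappa> \<theta>) ?P (\<lambda>u. (u, \<theta>))) = (\<integral>\<^sup>+u. f (u, \<theta>) \<partial>\<kappa> \<theta>)"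
      by (rule nn_integral_distr[OF measurable_Pair_kernel[OF \<theta>]]) simp
  qed
  finally show ?thesis .
qed

section \<open>The conditional distribution function weighted by 1-u\<close>

definition cut_mean :: "'a \<Rightarrow> real \<Rightarrow> real" where
  "cut_mean \<theta> t = (\<integral>u. (1 - u) * indicator {..t} u \<partial>\<kappa> \<theta>)"

lemma measurable_kernel_integral:
  fixes f :: "real \<Rightarrow> real"
  assumes "f \<in> borel_measurable borel"
  shows "(\<lambda>\<theta>. \<integral>u. f u \<partial>\<kappa> \<theta>) \<in> borel_measurable S_borel"
  by (rule measurable_compose[OF kernel_subprob])
     (rule integral_measurable_subprob_algebra, use assms in \<open>auto intro: measurable_restrict_space1\<close>)

lemma b_measurable [measurable]: "b_fun \<kappa> \<in> borel_measurable S_borel"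
  unfolding b_fun_def by (rule measurable_kernel_integral) auto

lemma cut_mean_measurable [measurable]: "(\<lambda>\<theta>. cut_mean \<theta> t) \<in> borel_measurable S_borel"
  unfolding cut_mean_def by (rule measurable_kernel_integral) auto

lemma F_measurable [measurable]: "(\<lambda>\<theta>. F_fun \<kappa> \<theta> t) \<in> borel_measurable S_borel"
proof -
  have "(LINT u:{0..t}|\<kappa> \<theta>. (1 - u)) = cut_mean \<theta> t" if "\<theta> \<in> S" for \<theta>
    unfolding set_lebesgue_integral_def cut_mean_def
    by (rule Bochner_Integration.integral_cong) (use that in \<open>auto simp: space_kernel indicator_def\<close>)
  then have "(\<lambda>\<theta>. F_fun \<kappa> \<theta> t) \<in> borel_measurable S_borel \<longleftrightarrow>
     (\<lambda>\<theta>. if t < 0 then 0 else if 1 \<le> t then 1 else (1 / b_fun \<kappa> \<theta>) * cut_mean \<theta> t) \<in> borel_measurable S_borel"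
    by (intro measurable_cong) (simp add: space_S_borel F_fun_def)
  then show ?thesis by auto
qed

lemma b_nonneg: "\<theta> \<in> S \<Longrightarrow> 0 \<le> b_fun \<kappa> \<theta>"
  unfolding b_fun_def by (rule Bochner_Integration.integral_nonneg_AE) (auto simp: space_kernel)

lemma integrable_cut: "\<theta> \<in> S \<Longrightarrow> A \<in> sets borel \<Longrightarrow> integrable (\<kappa> \<theta>) (\<lambda>u. (1 - u) * indicator A u)"
  by (rule integrable_kernel[where c = 1]) (auto simp: indicator_def)

lemma cut_mean_mono: "\<theta> \<in> S \<Longrightarrow> s \<le> t \<Longrightarrow> cut_mean \<theta> s \<le> cut_mean \<theta> t"
  unfolding cut_mean_def
  by (intro integral_mono_AE integrable_cut) (auto simp: space_kernel indicator_def)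

lemma cut_mean_neg: "\<theta> \<in> S \<Longrightarrow> t < 0 \<Longrightarrow> cut_mean \<theta> t = 0"
  unfolding cut_mean_def by (intro integral_eq_zero_AE) (auto simp: space_kernel indicator_def)

lemma cut_mean_ge_1: "\<theta> \<in> S \<Longrightarrow> 1 \<le> t \<Longrightarrow> cut_mean \<theta> t = b_fun \<kappa> \<theta>"
  unfolding cut_mean_def b_fun_def
  by (intro Bochner_Integration.integral_cong) (auto simp: space_kernel indicator_def)

text \<open>For b > 0 the quotient takes the values 0 below 0 and 1 from 1 on by itself, so the case
  distinction in \<open>F_fun\<close> disappears. For b = 0 the point mass of \<open>F_zero\<close>
  takes over, hence the recurring split on b.\<close>

lemma F_eq:
  assumes "\<theta> \<in> S" "0 < b_fun \<kappa> \<theta>" shows "F_fun \<kappa> \<theta> t = cut_mean \<theta> t / b_fun \<kappa> \<theta>"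
proof -
  have "(LINT u:{0..t}|\<kappa> \<theta>. (1 - u)) = cut_mean \<theta> t"
    unfolding set_lebesgue_integral_def cut_mean_def
    by (rule Bochner_Integration.integral_cong) (use assms in \<open>auto simp: space_kernel indicator_def\<close>)
  then show ?thesis using assms by (simp add: F_fun_def cut_mean_neg cut_mean_ge_1)
qed

lemma F_zero: "b_fun \<kappa> \<theta> = 0 \<Longrightarrow> F_fun \<kappa> \<theta> t = (if t < 1 then 0 else 1)"
  by (simp add: F_fun_def)

lemma F_mono:
  assumes "\<theta> \<in> S" "s \<le> t" shows "F_fun \<kappa> \<theta> s \<le> F_fun \<kappa> \<theta> t"
proof (cases "b_fun \<kappa> \<theta> = 0")
  case False
  then have "0 < b_fun \<kappa> \<theta>" using b_nonneg assms by fastforce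
  then show ?thesis using assms by (auto simp: F_eq intro!: divide_right_mono cut_mean_mono)
qed (use assms in \<open>auto simp: F_zero\<close>)

lemma F_ge_1: "1 \<le> t \<Longrightarrow> F_fun \<kappa> \<theta> t = 1"
  by (simp add: F_fun_def)

lemma F_neg: "t < 0 \<Longrightarrow> F_fun \<kappa> \<theta> t = 0"
  by (simp add: F_fun_def)

lemma cut_mean_right:
  assumes \<theta>: "\<theta> \<in> S" shows "(\<lambda>n. cut_mean \<theta> (t + 1 / real (Suc n))) \<longlonglongrightarrow> cut_mean \<theta> t"
  unfolding cut_mean_def
proof (rule integral_dominated_convergence[where w = "\<lambda>_. 1"])
  interpret K: prob_space "\<kappa> \<theta>" by (rule prob_kernel) fact
  show "integrable (\<kappa> \<theta>) (\<lambda>_. 1::real)" by simp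
  show "AE u in \<kappa> \<theta>. (\<lambda>n. (1 - u) * indicator {..t + 1 / real (Suc n)} u) \<longlonglongrightarrow> (1 - u) * indicator {..t} u"
  proof (rule AE_I2, rule tendsto_mult_left)
    fix u :: real
    show "(\<lambda>n. indicator {..t + 1 / real (Suc n)} u :: real) \<longlonglongrightarrow> indicator {..t} u"
    proof (cases "u \<le> t")
      case True
      then have "(\<lambda>n. indicator {..t + 1 / real (Suc n)} u :: real) = (\<lambda>_. 1)"
        by (auto simp: indicator_def fun_eq_iff add_increasing2)
      then show ?thesis using True by simp
    next
      case False
      have "(\<lambda>n. t + 1 / real (Suc n)) \<longlonglongrightarrow> t + 0" by (intro tendsto_intros LIMSEQ_Suc lim_1_over_n)
      then have "\<forall>\<^sub>F n in sequentially. t + 1 / real (Suc n) < u"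
        using False by (intro order_tendstoD) auto
      then show ?thesis using False
        by (intro tendsto_eventually) (auto elim!: eventually_mono simp: indicator_def)
    qed
  qed
qed (use \<theta> in \<open>auto simp: space_kernel indicator_def measurable_kernel\<close>)

text \<open>Approaching t from below loses a possible atom at t, so the open half-line appears in
  the limit. The contrast with \<open>cut_mean_right\<close> is what separates the two one-sided
  slopes of the conditional reward.\<close>

lemma integral_cut_left:
  assumes \<theta>: "\<theta> \<in> S"
  shows "(\<lambda>n. cut_mean \<theta> (t - 1 / real (Suc n))) \<longlonglongrightarrow> (\<integral>u. (1 - u) * indicator {..<t} u \<partial>\<kappa> \<theta>)"
  unfolding cut_mean_def
proof (rule integral_dominated_convergence[where w = "\<lambda>_. 1"])
  interpret K: prob_space "\<kappa> \<theta>" by (rule prob_kernel) fact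
  show "integrable (\<kappa> \<theta>) (\<lambda>_. 1::real)" by simp
  show "AE u in \<kappa> \<theta>. (\<lambda>n. (1 - u) * indicator {..t - 1 / real (Suc n)} u) \<longlonglongrightarrow> (1 - u) * indicator {..<t} u"
  proof (rule AE_I2, rule tendsto_mult_left)
    fix u :: real
    show "(\<lambda>n. indicator {..t - 1 / real (Suc n)} u :: real) \<longlonglongrightarrow> indicator {..<t} u"
    proof (cases "u < t")
      case False
      have "t - 1 / real (Suc n) < u" for n
        by (rule less_le_trans[of _ t]) (use False in simp_all)
      then have "(\<lambda>n. indicator {..t - 1 / real (Suc n)} u :: real) = (\<lambda>_. 0)"
        by (auto simp: indicator_def fun_eq_iff not_le)
      then show ?thesis using False by simp
    next
      case True
      have "(\<lambda>n. t - 1 / real (Suc n)) \<longlonglongrightarrow> t - 0" by (intro tendsto_intros LIMSEQ_Suc lim_1_over_n)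
      then have "\<forall>\<^sub>F n in sequentially. u < t - 1 / real (Suc n)"
        using True by (intro order_tendstoD) auto
      then show ?thesis using True
        by (intro tendsto_eventually) (auto elim!: eventually_mono simp: indicator_def)
    qed
  qed
qed (use \<theta> in \<open>auto simp: space_kernel indicator_def measurable_kernel\<close>)

text \<open>F inherits right continuity from \<open>cut_mean\<close>, as closed half-lines keep the
  atom at their end. The order form is the one that makes the infimum in \<open>q_fun\<close>
  attained.\<close>

lemma F_right:
  assumes \<theta>: "\<theta> \<in> S" and t: "\<And>s. t < s \<Longrightarrow> \<alpha> \<le> F_fun \<kappa> \<theta> s" shows "\<alpha> \<le> F_fun \<kappa> \<theta> t"
proof (cases "b_fun \<kappa> \<theta> = 0")
  case False
  then have b: "0 < b_fun \<kappa> \<theta>" using b_nonneg assms by fastforce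
  have "(\<lambda>n. F_fun \<kappa> \<theta> (t + 1 / real (Suc n))) \<longlonglongrightarrow> F_fun \<kappa> \<theta> t"
    unfolding F_eq[OF \<theta> b] using cut_mean_right[OF \<theta>] False by (intro tendsto_intros)
  then show ?thesis
    by (rule LIMSEQ_le_const) (auto intro!: t simp: divide_pos_pos)
next
  case True
  show ?thesis
  proof (cases "t < 1")
    case True
    \<comment> \<open>A point strictly between t and 1, where the point mass at 1 still gives F =
      0.\<close>
    then show ?thesis using t[of "(t+1)/2"] \<open>b_fun \<kappa> \<theta> = 0\<close> by (simp add: F_zero)
  next
    case False
    then show ?thesis using t[of "t+1"] by (simp add: F_ge_1)
  qed
qed

subsection \<open>Quantiles\<close>

lemma q_bounds:
  assumes "\<alpha> \<le> 1" shows "0 \<le> q_fun \<kappa> \<alpha> \<theta>" "q_fun \<kappa> \<alpha> \<theta> \<le> 1"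
proof -
  have "1 \<in> {t. 0 \<le> t \<and> \<alpha> \<le> F_fun \<kappa> \<theta> t}" using assms by (simp add: F_ge_1)
  moreover have "bdd_below {t. 0 \<le> t \<and> \<alpha> \<le> F_fun \<kappa> \<theta> t}" by (rule bdd_belowI[of _ 0]) auto
  ultimately show "q_fun \<kappa> \<alpha> \<theta> \<le> 1" "0 \<le> q_fun \<kappa> \<alpha> \<theta>"
    unfolding q_fun_def by (auto intro!: cInf_lower cInf_greatest)
qed

text \<open>The infimum is attained by \<open>F_right\<close>, so levels and quantiles form a Galois
  connection. Monotonicity, measurability and left continuity of \<open>q_fun\<close> are read off
  from it.\<close>

lemma q_le_iff:
  assumes \<theta>: "\<theta> \<in> S" and \<alpha>: "\<alpha> \<le> 1" and t: "0 \<le> t"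
  shows "q_fun \<kappa> \<alpha> \<theta> \<le> t \<longleftrightarrow> \<alpha> \<le> F_fun \<kappa> \<theta> t"
proof
  let ?X = "{t. 0 \<le> t \<and> \<alpha> \<le> F_fun \<kappa> \<theta> t}"
  have ne: "1 \<in> ?X" using \<alpha> by (simp add: F_ge_1)
  have bdd: "bdd_below ?X" by (rule bdd_belowI[of _ 0]) auto
  show "q_fun \<kappa> \<alpha> \<theta> \<le> t" if "\<alpha> \<le> F_fun \<kappa> \<theta> t"
    unfolding q_fun_def using that t by (intro cInf_lower bdd) auto
  assume le: "q_fun \<kappa> \<alpha> \<theta> \<le> t"
  show "\<alpha> \<le> F_fun \<kappa> \<theta> t"
  proof (rule F_right[OF \<theta>])
    fix s assume "t < s"
    then have "Inf ?X < s" using le by (simp add: q_fun_def)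
    then obtain r where "r \<in> ?X" "r < s" using cInf_lessD[of ?X s] ne by blast
    then show "\<alpha> \<le> F_fun \<kappa> \<theta> s" using F_mono[OF \<theta>, of r s] by auto
  qed
qed

lemma q_mono:
  assumes "\<theta> \<in> S" "\<alpha> \<le> \<beta>" "\<beta> \<le> 1" shows "q_fun \<kappa> \<alpha> \<theta> \<le> q_fun \<kappa> \<beta> \<theta>"
proof -
  have "\<beta> \<le> F_fun \<kappa> \<theta> (q_fun \<kappa> \<beta> \<theta>)"
    using q_le_iff[of \<theta> \<beta> "q_fun \<kappa> \<beta> \<theta>"] q_bounds[of \<beta> \<theta>] assms by auto
  then show ?thesis using q_le_iff[of \<theta> \<alpha> "q_fun \<kappa> \<beta> \<theta>"] q_bounds[of \<beta> \<theta>] assms by auto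
qed

lemma q_zero: "\<theta> \<in> S \<Longrightarrow> q_fun \<kappa> 0 \<theta> = 0"
  using q_le_iff[of \<theta> 0 0] F_mono[of \<theta> "-1" 0] q_bounds[of 0 \<theta>] by (simp add: F_neg)

lemma q_plus_bounds:
  assumes "\<alpha> < 1" shows "0 \<le> q_plus \<kappa> \<alpha> \<theta>" "q_plus \<kappa> \<alpha> \<theta> \<le> 1"
proof -
  have "1 \<in> {t. 0 \<le> t \<and> \<alpha> < F_fun \<kappa> \<theta> t}" using assms by (simp add: F_ge_1)
  moreover have "bdd_below {t. 0 \<le> t \<and> \<alpha> < F_fun \<kappa> \<theta> t}" by (rule bdd_belowI[of _ 0]) auto
  ultimately show "q_plus \<kappa> \<alpha> \<theta> \<le> 1" "0 \<le> q_plus \<kappa> \<alpha> \<theta>"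
    unfolding q_plus_def using assms by (auto intro!: cInf_lower cInf_greatest)
qed

text \<open>The set where F exceeds \<alpha> need not contain its infimum, so \<open>q_plus\<close>
  admits no equivalence like \<open>q_le_iff\<close>. This implication and
  \<open>F_greater_q_plus\<close>, both from strict inequalities on t, replace it.\<close>

lemma F_less_q_plus:
  assumes "0 \<le> \<alpha>" "\<alpha> < 1" "t < q_plus \<kappa> \<alpha> \<theta>" shows "F_fun \<kappa> \<theta> t \<le> \<alpha>"
proof (rule ccontr)
  assume *: "\<not> F_fun \<kappa> \<theta> t \<le> \<alpha>"
  then have "0 \<le> t" using F_neg[of t \<theta>] assms(1) by force
  then have "q_plus \<kappa> \<alpha> \<theta> \<le> t"
    unfolding q_plus_def using assms * by (auto intro!: cInf_lower bdd_belowI[of _ 0])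
  then show False using assms by simp
qed

lemma F_greater_q_plus:
  assumes "\<theta> \<in> S" "\<alpha> < 1" "q_plus \<kappa> \<alpha> \<theta> < t" shows "\<alpha> < F_fun \<kappa> \<theta> t"
proof -
  let ?X = "{t. 0 \<le> t \<and> \<alpha> < F_fun \<kappa> \<theta> t}"
  have "1 \<in> ?X" using assms by (simp add: F_ge_1)
  moreover have "Inf ?X < t" using assms by (simp add: q_plus_def)
  ultimately obtain r where "r \<in> ?X" "r < t" using cInf_lessD[of ?X t] by blast
  then show ?thesis using F_mono[OF assms(1), of r t] by auto
qed

lemma q_le_q_plus:
  assumes "\<theta> \<in> S" "\<alpha> < 1" shows "q_fun \<kappa> \<alpha> \<theta> \<le> q_plus \<kappa> \<alpha> \<theta>"
proof (rule dense_ge)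
  fix t assume t: "q_plus \<kappa> \<alpha> \<theta> < t"
  then have "0 \<le> t" using q_plus_bounds[of \<alpha> \<theta>] assms by linarith
  then show "q_fun \<kappa> \<alpha> \<theta> \<le> t"
    using F_greater_q_plus[OF assms t] q_le_iff[of \<theta> \<alpha> t] assms by simp
qed

lemma q_plus_le_q:
  assumes "\<theta> \<in> S" "0 \<le> \<alpha>" "\<alpha> < \<beta>" "\<beta> \<le> 1" shows "q_plus \<kappa> \<alpha> \<theta> \<le> q_fun \<kappa> \<beta> \<theta>"
proof (rule ccontr)
  assume "\<not> q_plus \<kappa> \<alpha> \<theta> \<le> q_fun \<kappa> \<beta> \<theta>"
  then have "F_fun \<kappa> \<theta> (q_fun \<kappa> \<beta> \<theta>) \<le> \<alpha>"
    using assms by (intro F_less_q_plus) auto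
  then show False using q_le_iff[of \<theta> \<beta> "q_fun \<kappa> \<beta> \<theta>"] q_bounds[of \<beta> \<theta>] assms by auto
qed

text \<open>By \<open>q_le_iff\<close>, t < q_\<alpha> means F(t) < \<alpha> when t is nonnegative,
  and this is an open condition on the level. Monotonicity bounds the quantiles from above.\<close>

lemma q_tendsto_left:
  assumes \<theta>: "\<theta> \<in> S" and \<alpha>: "\<alpha> \<le> 1" "\<And>n. a n \<le> \<alpha>" "a \<longlonglongrightarrow> \<alpha>"
  shows "(\<lambda>n. q_fun \<kappa> (a n) \<theta>) \<longlonglongrightarrow> q_fun \<kappa> \<alpha> \<theta>"
proof (rule order_tendstoI)
  fix t assume t: "t < q_fun \<kappa> \<alpha> \<theta>"
  show "\<forall>\<^sub>F n in sequentially. t < q_fun \<kappa> (a n) \<theta>"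
  proof (cases "0 \<le> t")
    case True
    then have "F_fun \<kappa> \<theta> t < \<alpha>" using q_le_iff[OF \<theta> \<alpha>(1) True] t by simp
    then have "\<forall>\<^sub>F n in sequentially. F_fun \<kappa> \<theta> t < a n" by (rule order_tendstoD(1)[OF \<alpha>(3)])
    then show ?thesis
    proof eventually_elim
      case (elim n)
      then show ?case using q_le_iff[OF \<theta> _ True, of "a n"] \<alpha>(1) \<alpha>(2)[of n] by simp
    qed
  next
    case False
    have "0 \<le> q_fun \<kappa> (a n) \<theta>" for n using q_bounds(1)[of "a n" \<theta>] \<alpha>(1) \<alpha>(2)[of n] by simp
    then show ?thesis using False by (intro always_eventually) (auto simp: not_le intro: less_le_trans)
  qed
next
  fix t assume "q_fun \<kappa> \<alpha> \<theta> < t"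
  then show "\<forall>\<^sub>F n in sequentially. q_fun \<kappa> (a n) \<theta> < t"
    using q_mono[OF \<theta> \<alpha>(2) \<alpha>(1)] by (intro always_eventually) (auto intro: le_less_trans)
qed

text \<open>Any s beyond \<open>q_plus\<close> has F(s) > \<alpha>, so eventually F(s) >
  \<open>a n\<close> and the quantiles drop to s or below; from below they are held by
  \<open>q_plus_le_q\<close>. The limit yields the measurability of \<open>q_plus\<close> and the
  upper end of the gap in \<open>exists_level\<close>.\<close>

lemma q_tendsto_right:
  assumes \<theta>: "\<theta> \<in> S" and \<alpha>: "0 \<le> \<alpha>" "\<And>n. \<alpha> < a n" "\<And>n. a n \<le> 1" "a \<longlonglongrightarrow> \<alpha>"
  shows "(\<lambda>n. q_fun \<kappa> (a n) \<theta>) \<longlonglongrightarrow> q_plus \<kappa> \<alpha> \<theta>"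
proof (rule order_tendstoI)
  have \<alpha>1: "\<alpha> < 1" using \<alpha>(2,3)[of 0] by simp
  fix t
  show "\<forall>\<^sub>F n in sequentially. t < q_fun \<kappa> (a n) \<theta>" if "t < q_plus \<kappa> \<alpha> \<theta>"
    using q_plus_le_q[OF \<theta> \<alpha>(1,2,3)] that by (intro always_eventually) (auto intro: less_le_trans)
  assume "q_plus \<kappa> \<alpha> \<theta> < t"
  then obtain s where s: "q_plus \<kappa> \<alpha> \<theta> < s" "s < t" using dense by blast
  have "0 \<le> s" using s q_plus_bounds[OF \<alpha>1, of \<theta>] by linarith
  have "\<forall>\<^sub>F n in sequentially. a n < F_fun \<kappa> \<theta> s"
    using F_greater_q_plus[OF \<theta> \<alpha>1 s(1)] by (rule order_tendstoD(2)[OF \<alpha>(4)])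
  then show "\<forall>\<^sub>F n in sequentially. q_fun \<kappa> (a n) \<theta> < t"
  proof eventually_elim
    case (elim n)
    then have "q_fun \<kappa> (a n) \<theta> \<le> s" using q_le_iff[OF \<theta> \<alpha>(3) \<open>0 \<le> s\<close>] by simp
    then show ?case using s by simp
  qed
qed

lemma q_measurable:
  assumes "\<alpha> \<le> 1" shows "q_fun \<kappa> \<alpha> \<in> borel_measurable S_borel"
proof (rule borel_measurableI_le)
  fix t
  show "{\<theta> \<in> space S_borel. q_fun \<kappa> \<alpha> \<theta> \<le> t} \<in> sets S_borel"
  proof (cases "0 \<le> t")
    case True
    then have "{\<theta> \<in> space S_borel. q_fun \<kappa> \<alpha> \<theta> \<le> t} = {\<theta> \<in> space S_borel. \<alpha> \<le> F_fun \<kappa> \<theta> t}"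
      using q_le_iff assms by (auto simp: space_S_borel)
    then show ?thesis by simp
  next
    case False
    then have "{\<theta> \<in> space S_borel. q_fun \<kappa> \<alpha> \<theta> \<le> t} = {}"
      using q_bounds(1)[OF assms] by (force simp: not_le intro: less_le_trans)
    then show ?thesis by (simp only: sets.empty_sets)
  qed
qed

text \<open>The infimum runs over uncountably many t and need not be attained, so measurability is
  obtained from countably many quantiles at larger levels.\<close>

lemma q_plus_measurable:
  assumes "0 \<le> \<alpha>" "\<alpha> < 1" shows "q_plus \<kappa> \<alpha> \<in> borel_measurable S_borel"
proof (rule borel_measurable_LIMSEQ_real)
  \<comment> \<open>At n = 0 the level is exactly 1, the largest one at which \<open>q_fun\<close>
    is controlled.\<close>
  let ?a = "\<lambda>n. \<alpha> + (1 - \<alpha>) / real (Suc n)"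
  have "?a \<longlonglongrightarrow> \<alpha> + 0" by (intro tendsto_intros LIMSEQ_Suc lim_const_over_n)
  moreover have "?a n \<le> 1" for n
    using assms divide_left_mono[of 1 "real (Suc n)" "1 - \<alpha>"] by simp
  ultimately show "(\<lambda>n. q_fun \<kappa> (?a n) \<theta>) \<longlonglongrightarrow> q_plus \<kappa> \<alpha> \<theta>" if "\<theta> \<in> space S_borel" for \<theta>
    using assms that by (intro q_tendsto_right) (auto simp: space_S_borel)
  show "q_fun \<kappa> (?a n) \<in> borel_measurable S_borel" for n
    by (rule q_measurable) fact
qed

text \<open>The weight 1-u does not charge u = 1, so F tends to 1 already as t increases to 1, and a
  level \<alpha> < 1 is passed strictly before. This keeps the candidate finite wherever b >
  0.\<close>

lemma q_plus_less_1:
  assumes \<theta>: "\<theta> \<in> S" and b: "0 < b_fun \<kappa> \<theta>" and \<alpha>: "0 \<le> \<alpha>" "\<alpha> < 1"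
  shows "q_plus \<kappa> \<alpha> \<theta> < 1"
proof (rule ccontr)
  assume "\<not> q_plus \<kappa> \<alpha> \<theta> < 1"
  then have "q_plus \<kappa> \<alpha> \<theta> = 1" using q_plus_bounds[of \<alpha> \<theta>] \<alpha> by simp
  then have "cut_mean \<theta> (1 - 1 / real (Suc n)) \<le> \<alpha> * b_fun \<kappa> \<theta>" for n
    using F_less_q_plus[OF \<alpha>, of "1 - 1 / real (Suc n)" \<theta>] b by (simp add: F_eq[OF \<theta> b] field_simps)
  then have "(\<integral>u. (1 - u) * indicator {..<1} u \<partial>\<kappa> \<theta>) \<le> \<alpha> * b_fun \<kappa> \<theta>"
    by (intro LIMSEQ_le_const2[OF integral_cut_left[OF \<theta>]] exI allI impI)
  also have "(\<integral>u. (1 - u) * indicator {..<1} u \<partial>\<kappa> \<theta>) = b_fun \<kappa> \<theta>"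
    unfolding b_fun_def using \<theta>
    by (intro Bochner_Integration.integral_cong) (auto simp: space_kernel indicator_def)
  finally show False using b \<alpha> by simp
qed

lemma q_mix_bounds:
  assumes \<theta>: "\<theta> \<in> S" and \<alpha>: "\<alpha> < 1" and l: "0 \<le> l" "l \<le> 1"
  shows "q_fun \<kappa> \<alpha> \<theta> \<le> q_mix \<kappa> \<alpha> l \<theta>" "q_mix \<kappa> \<alpha> l \<theta> \<le> q_plus \<kappa> \<alpha> \<theta>"
proof -
  let ?q = "q_fun \<kappa> \<alpha> \<theta>" and ?r = "q_plus \<kappa> \<alpha> \<theta>"
  have "?q \<le> ?r" by (rule q_le_q_plus[OF \<theta> \<alpha>])
  then have "0 \<le> l * (?r - ?q)" "0 \<le> (1 - l) * (?r - ?q)" using l by auto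
  then show "?q \<le> q_mix \<kappa> \<alpha> l \<theta>" "q_mix \<kappa> \<alpha> l \<theta> \<le> ?r"
    by (auto simp: q_mix_def algebra_simps)
qed

subsection \<open>The conditional Lagrangian\<close>

text \<open>By \<open>q_le_iff\<close> at least the fraction \<alpha> of the weighted mass b lies at
  or below q, and only the rest is left beyond q. With \<alpha> = 1 nothing is left beyond q_1,
  which \<open>U_le_q_one\<close> exploits.\<close>

lemma tail_le:
  assumes \<theta>: "\<theta> \<in> S" and \<alpha>: "\<alpha> \<le> 1" and q: "q_fun \<kappa> \<alpha> \<theta> \<le> q"
  shows "(\<integral>u. (1 - u) * indicator {q<..} u \<partial>\<kappa> \<theta>) \<le> (1 - \<alpha>) * b_fun \<kappa> \<theta>"
proof -
  have "b_fun \<kappa> \<theta> = (\<integral>u. (1 - u) * indicator {..q} u + (1 - u) * indicator {q<..} u \<partial>\<kappa> \<theta>)"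
    unfolding b_fun_def by (intro Bochner_Integration.integral_cong) (auto simp: indicator_def)
  also have "\<dots> = cut_mean \<theta> q + (\<integral>u. (1 - u) * indicator {q<..} u \<partial>\<kappa> \<theta>)"
    unfolding cut_mean_def by (intro Bochner_Integration.integral_add integrable_cut[OF \<theta>]) auto
  finally have *: "b_fun \<kappa> \<theta> = \<dots>" .
  have "\<alpha> * b_fun \<kappa> \<theta> \<le> cut_mean \<theta> q"
  proof (cases "b_fun \<kappa> \<theta> = 0")
    case True
    \<comment> \<open>\<open>min q (-1)\<close> is a negative point at or below q, where
      \<open>cut_mean\<close> is 0; hence \<open>cut_mean \<theta> q\<close> is nonnegative.\<close>
    then show ?thesis using cut_mean_mono[OF \<theta>, of "min q (-1)" q] cut_mean_neg[OF \<theta>, of "min q (-1)"] by simp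
  next
    case False
    then have b: "0 < b_fun \<kappa> \<theta>" using b_nonneg[OF \<theta>] by simp
    have "0 \<le> q" using q q_bounds[OF \<alpha>, of \<theta>] by linarith
    then show ?thesis using q_le_iff[OF \<theta> \<alpha>, of q] q b by (simp add: F_eq[OF \<theta> b] field_simps)
  qed
  with * show ?thesis unfolding left_diff_distrib by linarith
qed

text \<open>Points strictly below q lie strictly below \<open>q_plus\<close>, so F is at most
  \<alpha> there. At q itself F may count an atom, which is why the argument uses the left limit and
  the tail includes q.\<close>

lemma tail_ge:
  assumes \<theta>: "\<theta> \<in> S" and \<alpha>: "0 \<le> \<alpha>" "\<alpha> < 1" and q: "q \<le> q_plus \<kappa> \<alpha> \<theta>"
  shows "(1 - \<alpha>) * b_fun \<kappa> \<theta> \<le> (\<integral>u. (1 - u) * indicator {q..} u \<partial>\<kappa> \<theta>)"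
proof -
  have "b_fun \<kappa> \<theta> = (\<integral>u. (1 - u) * indicator {..<q} u + (1 - u) * indicator {q..} u \<partial>\<kappa> \<theta>)"
    unfolding b_fun_def by (intro Bochner_Integration.integral_cong) (auto simp: indicator_def)
  also have "\<dots> = (\<integral>u. (1 - u) * indicator {..<q} u \<partial>\<kappa> \<theta>) + (\<integral>u. (1 - u) * indicator {q..} u \<partial>\<kappa> \<theta>)"
    by (intro Bochner_Integration.integral_add integrable_cut[OF \<theta>]) auto
  finally have *: "b_fun \<kappa> \<theta> = \<dots>" .
  have "(\<integral>u. (1 - u) * indicator {..<q} u \<partial>\<kappa> \<theta>) \<le> \<alpha> * b_fun \<kappa> \<theta>"
  proof (rule LIMSEQ_le_const2[OF integral_cut_left[OF \<theta>]], intro exI allI impI)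
    fix n
    show "cut_mean \<theta> (q - 1 / real (Suc n)) \<le> \<alpha> * b_fun \<kappa> \<theta>"
    proof (cases "b_fun \<kappa> \<theta> = 0")
      case True
      then show ?thesis
        using cut_mean_mono[OF \<theta>, of "q - 1 / real (Suc n)" "max 1 q"] cut_mean_ge_1[OF \<theta>, of "max 1 q"]
        by (simp add: le_max_iff_disj diff_le_eq add_increasing2)
    next
      case False
      then have b: "0 < b_fun \<kappa> \<theta>" using b_nonneg[OF \<theta>] by simp
      have "q - 1 / real (Suc n) < q_plus \<kappa> \<alpha> \<theta>"
        using q by (rule less_le_trans[rotated]) simp
      then have "F_fun \<kappa> \<theta> (q - 1 / real (Suc n)) \<le> \<alpha>" by (rule F_less_q_plus[OF \<alpha>])
      then show ?thesis using b by (simp only: F_eq[OF \<theta> b] pos_divide_le_eq)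
    qed
  qed
  with * show ?thesis unfolding left_diff_distrib by linarith
qed

text \<open>On {u >= q} the weight 1-u is at most 1-q, so \<open>tail_ge\<close> yields (1-\<alpha>)
  b <= 1-q; it remains to multiply by q <= 1 and divide. The bound does not depend on \<theta> and
  can therefore serve as a dominating constant.\<close>

lemma b_over_le:
  assumes \<theta>: "\<theta> \<in> S" and \<alpha>: "0 \<le> \<alpha>" "\<alpha> < 1" and q: "0 \<le> q" "q \<le> q_plus \<kappa> \<alpha> \<theta>" "q < 1"
  shows "b_fun \<kappa> \<theta> * (q / (1 - q)) \<le> 1 / (1 - \<alpha>)"
proof -
  interpret K: prob_space "\<kappa> \<theta>" by (rule prob_kernel) fact
  have "(1 - \<alpha>) * b_fun \<kappa> \<theta> \<le> (\<integral>u. (1 - u) * indicator {q..} u \<partial>\<kappa> \<theta>)"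
    by (rule tail_ge) fact+
  also have "\<dots> \<le> (\<integral>u. 1 - q \<partial>\<kappa> \<theta>)"
    using q by (intro integral_mono_AE integrable_cut[OF \<theta>]) (auto simp: indicator_def)
  finally have "(1 - \<alpha>) * b_fun \<kappa> \<theta> \<le> 1 - q" by (simp add: K.prob_space)
  then have "(1 - \<alpha>) * b_fun \<kappa> \<theta> * q \<le> (1 - q) * 1"
    using q \<alpha> b_nonneg[OF \<theta>] by (intro mult_mono) auto
  then show ?thesis using q \<alpha> by (simp add: field_simps)
qed

text \<open>A supergradient inequality: given \<theta>, the concave function y \<mapsto>
  E[min(U, (1-U) y)] has the supergradient (1-\<alpha>) b at x = q/(1-q). It comes from integrating
  a pointwise comparison on either side of x, so nothing is differentiated.\<close>

lemma lagrange_kernel: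
  assumes \<theta>: "\<theta> \<in> S" and \<alpha>: "0 \<le> \<alpha>" "\<alpha> < 1"
    and q: "q_fun \<kappa> \<alpha> \<theta> \<le> q" "q \<le> q_plus \<kappa> \<alpha> \<theta>" "q < 1" and y: "0 \<le> y"
  shows "(\<integral>u. min u ((1 - u) * y) \<partial>\<kappa> \<theta>) + (1 - \<alpha>) * b_fun \<kappa> \<theta> * (q / (1 - q))
       \<le> (\<integral>u. min u ((1 - u) * (q / (1 - q))) \<partial>\<kappa> \<theta>) + (1 - \<alpha>) * b_fun \<kappa> \<theta> * y"
proof -
  define x where "x = q / (1 - q)"
  have q0: "0 \<le> q" using q(1) q_bounds(1)[of \<alpha> \<theta>] \<alpha> by linarith
  have x0: "0 \<le> x" using q0 q by (simp add: x_def)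
  \<comment> \<open>At y = x the two branches of the minimum cross exactly at u = q.\<close>
  have x1: "(1 - u) * x \<le> u \<longleftrightarrow> q \<le> u" for u
    using q by (simp add: x_def field_simps)
  have x2: "(1 - u) * x < u \<longleftrightarrow> q < u" for u
    using q by (simp add: x_def field_simps)
  have int: "integrable (\<kappa> \<theta>) (\<lambda>u. min u ((1 - u) * z))" if "0 \<le> z" for z
    using that by (intro integrable_kernel[OF \<theta>, of _ 1]) (auto simp: min_def)
  show ?thesis
  proof (cases "x \<le> y")
    case True
    \<comment> \<open>For u <= q the minimum is already u at x, and raising x to y gains nothing;
      for u > q it grows at rate at most 1-u.\<close>
    have "(\<integral>u. min u ((1 - u) * y) \<partial>\<kappa> \<theta>)
        \<le> (\<integral>u. min u ((1 - u) * x) + (y - x) * ((1 - u) * indicator {q<..} u) \<partial>\<kappa> \<theta>)"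
    proof (intro integral_mono_AE AE_I2)
      fix u assume "u \<in> space (\<kappa> \<theta>)"
      then have u: "0 \<le> u" "u \<le> 1" by (auto simp: space_kernel[OF \<theta>])
      show "min u ((1 - u) * y) \<le> min u ((1 - u) * x) + (y - x) * ((1 - u) * indicator {q<..} u)"
        using x2[of u] by (cases "q < u") (auto simp: algebra_simps min_def)
    qed (use int x0 y integrable_cut[OF \<theta>] in auto)
    also have "\<dots> = (\<integral>u. min u ((1 - u) * x) \<partial>\<kappa> \<theta>) + (y - x) * (\<integral>u. (1 - u) * indicator {q<..} u \<partial>\<kappa> \<theta>)"
      using int[OF x0] integrable_cut[OF \<theta>] by simp
    also have "\<dots> \<le> (\<integral>u. min u ((1 - u) * x) \<partial>\<kappa> \<theta>) + (y - x) * ((1 - \<alpha>) * b_fun \<kappa> \<theta>)"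
      using True tail_le[OF \<theta> _ q(1)] \<alpha> by (intro add_left_mono mult_left_mono) auto
    finally show ?thesis by (simp add: x_def[symmetric] algebra_simps)
  next
    case False
    have "(\<integral>u. min u ((1 - u) * y) \<partial>\<kappa> \<theta>) + (x - y) * ((1 - \<alpha>) * b_fun \<kappa> \<theta>)
      \<le> (\<integral>u. min u ((1 - u) * y) \<partial>\<kappa> \<theta>) + (x - y) * (\<integral>u. (1 - u) * indicator {q..} u \<partial>\<kappa> \<theta>)"
      using False tail_ge[OF \<theta> \<alpha> q(2)] by (intro add_left_mono mult_left_mono) auto
    also have "\<dots> = (\<integral>u. min u ((1 - u) * y) + (x - y) * ((1 - u) * indicator {q..} u) \<partial>\<kappa> \<theta>)"
      using int[OF y] integrable_cut[OF \<theta>] by simp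
    \<comment> \<open>For u >= q the branch (1-u) x is active at x, and as y < x also (1-u) y at y,
      so the increment is exactly (x-y)(1-u). For u < q monotonicity suffices.\<close>
    also have "\<dots> \<le> (\<integral>u. min u ((1 - u) * x) \<partial>\<kappa> \<theta>)"
    proof (intro integral_mono_AE AE_I2)
      fix u assume "u \<in> space (\<kappa> \<theta>)"
      then have u: "0 \<le> u" "u \<le> 1" by (auto simp: space_kernel[OF \<theta>])
      have "(1 - u) * y \<le> (1 - u) * x" using False u by (intro mult_left_mono) auto
      then show "min u ((1 - u) * y) + (x - y) * ((1 - u) * indicator {q..} u) \<le> min u ((1 - u) * x)"
        using x1[of u] by (cases "q \<le> u") (auto simp: algebra_simps min_def)
    qed (use int x0 y integrable_cut[OF \<theta>] in auto)
    finally show ?thesis by (simp add: x_def[symmetric] algebra_simps)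
  qed
qed

subsection \<open>Reduction to conditional expectations\<close>

lemma fst_measurable: "fst \<in> borel_measurable (unit_borel \<Otimes>\<^sub>M S_borel)"
  by (rule measurable_compose[OF measurable_fst]) (rule measurable_restrict_space1, simp)

lemma nn_integral_kernel:
  assumes "\<theta> \<in> S" "f \<in> borel_measurable borel" "\<And>u. 0 \<le> u \<Longrightarrow> u \<le> 1 \<Longrightarrow> 0 \<le> f u \<and> f u \<le> 1"
  shows "(\<integral>\<^sup>+u. ennreal (f u) \<partial>\<kappa> \<theta>) = ennreal (\<integral>u. f u \<partial>\<kappa> \<theta>)"
  using assms by (intro nn_integral_eq_integral integrable_kernel[where c = 1]) (auto simp: space_kernel)

text \<open>\<open>h\<close> may take the value top, as \<open>odds\<close> does at 1. This is the
  passage to integrals against the measure b(theta) p_Theta(d theta), made before any finiteness is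
  known.\<close>

lemma nn_expectation_weighted:
  assumes h [measurable]: "h \<in> borel_measurable S_borel"
  shows "(\<integral>\<^sup>+\<omega>. ennreal (1 - U \<omega>) * h (\<Theta> \<omega>) \<partial>M) = (\<integral>\<^sup>+\<theta>. ennreal (b_fun \<kappa> \<theta>) * h \<theta> \<partial>law)"
proof -
  note fst_measurable [measurable]
  have "(\<integral>\<^sup>+\<omega>. ennreal (1 - U \<omega>) * h (\<Theta> \<omega>) \<partial>M)
      = (\<integral>\<^sup>+\<omega>. (\<lambda>x. ennreal (1 - fst x) * h (snd x)) (U \<omega>, \<Theta> \<omega>) \<partial>M)" by simp
  also have "\<dots> = (\<integral>\<^sup>+\<theta>. \<integral>\<^sup>+u. ennreal (1 - u) * h \<theta> \<partial>\<kappa> \<theta> \<partial>law)"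
    by (subst disintegration) simp_all
  also have "\<dots> = (\<integral>\<^sup>+\<theta>. ennreal (b_fun \<kappa> \<theta>) * h \<theta> \<partial>law)"
  proof (rule nn_integral_cong)
    fix \<theta> assume "\<theta> \<in> space law"
    then have \<theta>: "\<theta> \<in> S" by (simp add: space_S_borel)
    have "(\<integral>\<^sup>+u. ennreal (1 - u) * h \<theta> \<partial>\<kappa> \<theta>) = (\<integral>\<^sup>+u. ennreal (1 - u) \<partial>\<kappa> \<theta>) * h \<theta>"
      by (intro nn_integral_multc measurable_kernel[OF \<theta>] measurable_compose[OF _ measurable_ennreal])
        (use measurable_kernel[OF \<theta>] in auto)
    also have "(\<integral>\<^sup>+u. ennreal (1 - u) \<partial>\<kappa> \<theta>) = ennreal (b_fun \<kappa> \<theta>)"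
      unfolding b_fun_def by (rule nn_integral_kernel[OF \<theta>]) auto
    finally show "(\<integral>\<^sup>+u. ennreal (1 - u) * h \<theta> \<partial>\<kappa> \<theta>) = ennreal (b_fun \<kappa> \<theta>) * h \<theta>" .
  qed
  finally show ?thesis .
qed

lemma feasible_iff:
  "g \<in> feasible M U \<Theta> S c \<longleftrightarrow> g \<in> borel_measurable S_borel \<and> (\<forall>\<theta>\<in>S. 0 \<le> g \<theta>) \<and>
     (\<integral>\<^sup>+\<theta>. ennreal (b_fun \<kappa> \<theta>) * ennreal (g \<theta>) \<partial>law) = ennreal c"
proof -
  have "(\<integral>\<^sup>+\<omega>. ennreal ((1 - U \<omega>) * g (\<Theta> \<omega>)) \<partial>M) = (\<integral>\<^sup>+\<theta>. ennreal (b_fun \<kappa> \<theta>) * ennreal (g \<theta>) \<partial>law)"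
    if g [measurable]: "g \<in> borel_measurable S_borel"
  proof -
    have "(\<integral>\<^sup>+\<omega>. ennreal ((1 - U \<omega>) * g (\<Theta> \<omega>)) \<partial>M) = (\<integral>\<^sup>+\<omega>. ennreal (1 - U \<omega>) * ennreal (g (\<Theta> \<omega>)) \<partial>M)"
      using U_bounds by (intro nn_integral_cong ennreal_mult') auto
    also have "\<dots> = (\<integral>\<^sup>+\<theta>. ennreal (b_fun \<kappa> \<theta>) * ennreal (g \<theta>) \<partial>law)"
      by (rule nn_expectation_weighted) simp
    finally show ?thesis .
  qed
  then show ?thesis by (auto simp: feasible_def)
qed

lemma reward_measurable:
  assumes [measurable]: "g \<in> borel_measurable S_borel"
  shows "(\<lambda>\<omega>. min (U \<omega>) ((1 - U \<omega>) * g (\<Theta> \<omega>))) \<in> borel_measurable M"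
proof -
  note \<Theta>_meas [measurable]
  show ?thesis by measurable
qed

lemma reward_integrable:
  assumes [measurable]: "g \<in> borel_measurable S_borel" and g0: "\<forall>\<theta>\<in>S. 0 \<le> g \<theta>"
  shows "integrable M (\<lambda>\<omega>. min (U \<omega>) ((1 - U \<omega>) * g (\<Theta> \<omega>)))"
proof (rule integrable_const_bound[of _ 1])
  show "AE \<omega> in M. norm (min (U \<omega>) ((1 - U \<omega>) * g (\<Theta> \<omega>))) \<le> 1"
  proof (rule AE_I2)
    fix \<omega> assume "\<omega> \<in> space M"
    then show "norm (min (U \<omega>) ((1 - U \<omega>) * g (\<Theta> \<omega>))) \<le> 1"
      using U_bounds[of \<omega>] g0 \<Theta>_in[of \<omega>] by (auto simp: min_def)
  qed
qed (rule reward_measurable, fact)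

lemma reward_disintegration:
  assumes [measurable]: "g \<in> borel_measurable S_borel" and g0: "\<forall>\<theta>\<in>S. 0 \<le> g \<theta>"
  shows "ennreal (\<integral>\<omega>. min (U \<omega>) ((1 - U \<omega>) * g (\<Theta> \<omega>)) \<partial>M)
    = (\<integral>\<^sup>+\<theta>. ennreal (\<integral>u. min u ((1 - u) * g \<theta>) \<partial>\<kappa> \<theta>) \<partial>law)"
proof -
  note fst_measurable [measurable]
  have "ennreal (\<integral>\<omega>. min (U \<omega>) ((1 - U \<omega>) * g (\<Theta> \<omega>)) \<partial>M)
      = (\<integral>\<^sup>+\<omega>. (\<lambda>x. ennreal (min (fst x) ((1 - fst x) * g (snd x)))) (U \<omega>, \<Theta> \<omega>) \<partial>M)"
    unfolding fst_conv snd_conv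
    by (rule nn_integral_eq_integral[symmetric, OF reward_integrable[OF assms]])
      (use g0 U_bounds \<Theta>_in in auto)
  also have "\<dots> = (\<integral>\<^sup>+\<theta>. \<integral>\<^sup>+u. ennreal (min u ((1 - u) * g \<theta>)) \<partial>\<kappa> \<theta> \<partial>law)"
    by (subst disintegration) simp_all
  also have "\<dots> = (\<integral>\<^sup>+\<theta>. ennreal (\<integral>u. min u ((1 - u) * g \<theta>) \<partial>\<kappa> \<theta>) \<partial>law)"
    using g0 by (intro nn_integral_cong nn_integral_kernel) (auto simp: space_S_borel)
  finally show ?thesis .
qed

text \<open>As g \<theta> sits inside the kernel integral, joint measurability of the integrand is
  required, with the coordinates in the order (\<theta>, u), opposite to the one in
  \<open>joint_law\<close>.\<close>

lemma reward_kernel_measurable: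
  assumes [measurable]: "g \<in> borel_measurable S_borel" and g0: "\<forall>\<theta>\<in>S. 0 \<le> g \<theta>"
  shows "(\<lambda>\<theta>. ennreal (\<integral>u. min u ((1 - u) * g \<theta>) \<partial>\<kappa> \<theta>)) \<in> borel_measurable S_borel"
proof -
  note fst_measurable [measurable]
  have id [measurable]: "(\<lambda>x. x) \<in> borel_measurable unit_borel" by (rule measurable_restrict_space1) simp
  have "(\<lambda>x. ennreal (min (snd x) ((1 - snd x) * g (fst x)))) \<in> borel_measurable (S_borel \<Otimes>\<^sub>M unit_borel)"
  proof -
    have [measurable]: "snd \<in> borel_measurable (S_borel \<Otimes>\<^sub>M unit_borel)"
      by (rule measurable_compose[OF measurable_snd id])
    show ?thesis by measurable
  qed
  then have "(\<lambda>\<theta>. \<integral>\<^sup>+u. ennreal (min u ((1 - u) * g \<theta>)) \<partial>\<kappa> \<theta>) \<in> borel_measurable S_borel"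
    by (intro nn_integral_measurable_subprob_algebra2[OF _ kernel_subprob]) (simp add: split_beta)
  moreover have "(\<integral>\<^sup>+u. ennreal (min u ((1 - u) * g \<theta>)) \<partial>\<kappa> \<theta>) = ennreal (\<integral>u. min u ((1 - u) * g \<theta>) \<partial>\<kappa> \<theta>)"
    if "\<theta> \<in> space S_borel" for \<theta>
    using g0 that by (intro nn_integral_kernel) (auto simp: space_S_borel)
  ultimately show ?thesis by (subst (asm) measurable_cong) auto
qed

text \<open>Weak duality: after integration over the law of Theta the two multiplier terms have the
  same finite value \<nu> c, and they cancel.\<close>

lemma lagrange_sufficient:
  assumes g: "g \<in> feasible M U \<Theta> S c" and g': "g' \<in> feasible M U \<Theta> S c" and c: "0 \<le> c" and \<nu>: "0 \<le> \<nu>"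
    and opt: "\<And>\<theta> y. \<theta> \<in> S \<Longrightarrow> 0 \<le> y \<Longrightarrow>
       (\<integral>u. min u ((1 - u) * y) \<partial>\<kappa> \<theta>) + \<nu> * b_fun \<kappa> \<theta> * g \<theta>
     \<le> (\<integral>u. min u ((1 - u) * g \<theta>) \<partial>\<kappa> \<theta>) + \<nu> * b_fun \<kappa> \<theta> * y"
  shows "(\<integral>\<omega>. min (U \<omega>) ((1 - U \<omega>) * g' (\<Theta> \<omega>)) \<partial>M) \<le> (\<integral>\<omega>. min (U \<omega>) ((1 - U \<omega>) * g (\<Theta> \<omega>)) \<partial>M)"
proof -
  let ?J = "\<lambda>h. \<integral>\<omega>. min (U \<omega>) ((1 - U \<omega>) * h (\<Theta> \<omega>)) \<partial>M"
  let ?j = "\<lambda>y \<theta>. \<integral>u. min u ((1 - u) * y) \<partial>\<kappa> \<theta>"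
  have gm [measurable]: "g \<in> borel_measurable S_borel" "g' \<in> borel_measurable S_borel"
    and g0: "\<forall>\<theta>\<in>S. 0 \<le> g \<theta>" "\<forall>\<theta>\<in>S. 0 \<le> g' \<theta>"
    and gc: "(\<integral>\<^sup>+\<theta>. ennreal (b_fun \<kappa> \<theta>) * ennreal (g \<theta>) \<partial>law) = ennreal c"
        "(\<integral>\<^sup>+\<theta>. ennreal (b_fun \<kappa> \<theta>) * ennreal (g' \<theta>) \<partial>law) = ennreal c"
    using g g' by (auto simp: feasible_iff)
  have j0: "0 \<le> ?j y \<theta>" if "\<theta> \<in> S" "0 \<le> y" for \<theta> y
    using that by (intro Bochner_Integration.integral_nonneg_AE AE_I2) (auto simp: space_kernel)
  have J0: "0 \<le> ?J h" if "\<forall>\<theta>\<in>S. 0 \<le> h \<theta>" for h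
    using that U_bounds \<Theta>_in by (intro Bochner_Integration.integral_nonneg_AE AE_I2) auto
  \<comment> \<open>The reward of h is paired with the multiplier term of another function k, since
    each side of \<open>opt\<close> combines the reward of one of g, g' with the multiplier term of
    the other.\<close>
  have split: "ennreal (?J h) + ennreal (\<nu> * c)
     = (\<integral>\<^sup>+\<theta>. ennreal (?j (h \<theta>) \<theta>) + ennreal (\<nu> * b_fun \<kappa> \<theta> * k \<theta>) \<partial>law)"
    if [measurable]: "h \<in> borel_measurable S_borel" "k \<in> borel_measurable S_borel"
      and h0: "\<forall>\<theta>\<in>S. 0 \<le> h \<theta>" "\<forall>\<theta>\<in>S. 0 \<le> k \<theta>"
      and kc: "(\<integral>\<^sup>+\<theta>. ennreal (b_fun \<kappa> \<theta>) * ennreal (k \<theta>) \<partial>law) = ennreal c" for h k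
  proof -
    have "(\<integral>\<^sup>+\<theta>. ennreal (\<nu> * b_fun \<kappa> \<theta> * k \<theta>) \<partial>law)
        = (\<integral>\<^sup>+\<theta>. ennreal \<nu> * (ennreal (b_fun \<kappa> \<theta>) * ennreal (k \<theta>)) \<partial>law)"
      using h0 b_nonneg \<nu> by (intro nn_integral_cong) (simp add: ennreal_mult[symmetric] space_S_borel mult.assoc)
    also have "\<dots> = ennreal \<nu> * ennreal c"
      by (subst nn_integral_cmult) (simp_all add: kc)
    finally have "(\<integral>\<^sup>+\<theta>. ennreal (\<nu> * b_fun \<kappa> \<theta> * k \<theta>) \<partial>law) = ennreal (\<nu> * c)"
      using c \<nu> by (simp add: ennreal_mult)
    then show ?thesis
      using h0 reward_kernel_measurable[of h]
      by (subst nn_integral_add) (simp_all add: reward_disintegration)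
  qed
  have "ennreal (?J g') + ennreal (\<nu> * c)
      = (\<integral>\<^sup>+\<theta>. ennreal (?j (g' \<theta>) \<theta>) + ennreal (\<nu> * b_fun \<kappa> \<theta> * g \<theta>) \<partial>law)"
    by (rule split) (use g0 gc in auto)
  also have "\<dots> \<le> (\<integral>\<^sup>+\<theta>. ennreal (?j (g \<theta>) \<theta>) + ennreal (\<nu> * b_fun \<kappa> \<theta> * g' \<theta>) \<partial>law)"
  proof (rule nn_integral_mono)
    fix \<theta> assume "\<theta> \<in> space law"
    then have \<theta>: "\<theta> \<in> S" by (simp add: space_S_borel)
    then show "ennreal (?j (g' \<theta>) \<theta>) + ennreal (\<nu> * b_fun \<kappa> \<theta> * g \<theta>)
      \<le> ennreal (?j (g \<theta>) \<theta>) + ennreal (\<nu> * b_fun \<kappa> \<theta> * g' \<theta>)"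
      using opt[OF \<theta>, of "g' \<theta>"] g0 j0[OF \<theta>] b_nonneg[OF \<theta>] \<nu>
      by (simp add: ennreal_plus[symmetric] ennreal_leI del: ennreal_plus)
  qed
  also have "\<dots> = ennreal (?J g) + ennreal (\<nu> * c)"
    by (rule split[symmetric]) (use g0 gc in auto)
  finally have "ennreal (?J g' + \<nu> * c) \<le> ennreal (?J g + \<nu> * c)"
    using J0 g0 c \<nu> by simp
  then show ?thesis using J0 g0 c \<nu> by (subst (asm) ennreal_le_iff) auto
qed

section \<open>Moments of U and the upper bound on the reward\<close>

lemma U_integrable: "integrable M U"
  by (rule integrable_const_bound[of _ 1]) (use U_bounds in auto)

lemma expectation_U_pos:
  assumes "prob {\<omega> \<in> space M. U \<omega> = 0} < 1" shows "0 < expectation U"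
proof (rule ccontr)
  assume "\<not> 0 < expectation U"
  moreover have "0 \<le> expectation U" using U_bounds by (intro Bochner_Integration.integral_nonneg_AE AE_I2) auto
  ultimately have "AE \<omega> in M. U \<omega> = 0"
    using integral_nonneg_eq_0_iff_AE[OF U_integrable] U_bounds by auto
  then have "prob {\<omega> \<in> space M. U \<omega> = 0} = 1" by (subst prob_Collect_eq_1) auto
  then show False using assms by simp
qed

lemma truncated_expectation:
  "(\<integral>\<omega>. U \<omega> * indicator {..<1} (U \<omega>) \<partial>M) = expectation U - prob {\<omega> \<in> space M. U \<omega> = 1}"
proof -
  have "(\<integral>\<omega>. U \<omega> * indicator {..<1} (U \<omega>) \<partial>M) = (\<integral>\<omega>. U \<omega> - indicator {\<omega> \<in> space M. U \<omega> = 1} \<omega> \<partial>M)"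
    using U_bounds by (intro Bochner_Integration.integral_cong) (fastforce simp: indicator_def)+
  also have "\<dots> = expectation U - prob {\<omega> \<in> space M. U \<omega> = 1}"
    by (subst Bochner_Integration.integral_diff) (auto intro!: U_integrable integrable_real_indicator simp: less_top[symmetric])
  finally show ?thesis .
qed

text \<open>Where U = 1 the factor 1-U annihilates the second argument of the minimum, so no g earns
  anything there; elsewhere the reward is at most U. A saturating g meets both bounds.\<close>

lemma saturating_is_solution:
  assumes EU: "0 < expectation U"
    and g: "g \<in> feasible M U \<Theta> S (expectation U)"
    and sat: "AE \<omega> in M. U \<omega> < 1 \<longrightarrow> U \<omega> \<le> (1 - U \<omega>) * g (\<Theta> \<omega>)"
  shows "is_solution M U \<Theta> S g"
    and "Lambda M U \<Theta> g = (\<integral>\<omega>. U \<omega> * indicator {..<1} (U \<omega>) \<partial>M) / expectation U"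
proof -
  let ?J = "\<lambda>h. \<integral>\<omega>. min (U \<omega>) ((1 - U \<omega>) * h (\<Theta> \<omega>)) \<partial>M"
  let ?E = "\<integral>\<omega>. U \<omega> * indicator {..<1} (U \<omega>) \<partial>M"
  have feas: "h \<in> borel_measurable S_borel" "\<forall>\<theta>\<in>S. 0 \<le> h \<theta>"
    if "h \<in> feasible M U \<Theta> S (expectation U)" for h
    using that by (auto simp: feasible_def)
  have J: "?J g = ?E"
  proof (rule integral_cong_AE)
    show "(\<lambda>\<omega>. min (U \<omega>) ((1 - U \<omega>) * g (\<Theta> \<omega>))) \<in> borel_measurable M"
      using feas[OF g] by (intro reward_measurable)
    show "AE \<omega> in M. min (U \<omega>) ((1 - U \<omega>) * g (\<Theta> \<omega>)) = U \<omega> * indicator {..<1} (U \<omega>)"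
      using sat by (rule AE_mp) (auto intro!: AE_I2 simp: indicator_def min_def dest!: U_bounds)
  qed simp
  have J_le: "?J h \<le> ?E" if h: "h \<in> feasible M U \<Theta> S (expectation U)" for h
  proof (rule integral_mono_AE)
    show "integrable M (\<lambda>\<omega>. U \<omega> * indicator {..<1} (U \<omega>))"
      by (rule integrable_const_bound[of _ 1]) (use U_bounds in \<open>auto simp: indicator_def\<close>)
    show "AE \<omega> in M. min (U \<omega>) ((1 - U \<omega>) * h (\<Theta> \<omega>)) \<le> U \<omega> * indicator {..<1} (U \<omega>)"
      by (auto intro!: AE_I2 simp: indicator_def min_def dest!: U_bounds)
  qed (use feas[OF h] in \<open>rule reward_integrable\<close>)
  show "Lambda M U \<Theta> g = ?E / expectation U" by (simp add: Lambda_def J)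
  show "is_solution M U \<Theta> S g"
    using g J_le EU by (auto simp: is_solution_def Lambda_def J divide_right_mono)
qed

subsection \<open>Attaining the level in the constraint\<close>

text \<open>This is C as a function of the quantile, with values in [0,infinity] because level 1 may
  give infinity. \<open>mean_odds\<close> is the Bochner counterpart, to which dominated convergence
  and the intermediate value theorem apply; the two agree for quantiles bounded by
  \<open>q_plus\<close> at a level below 1.\<close>

definition nn_mean_odds :: "('a \<Rightarrow> real) \<Rightarrow> ennreal" where
  "nn_mean_odds f = (\<integral>\<^sup>+\<theta>. ennreal (b_fun \<kappa> \<theta>) * odds (f \<theta>) \<partial>law)"

definition mean_odds :: "('a \<Rightarrow> real) \<Rightarrow> real" where
  "mean_odds f = (\<integral>\<theta>. b_fun \<kappa> \<theta> * (f \<theta> / (1 - f \<theta>)) \<partial>law)"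

lemma prob_law: "prob_space law"
  by (rule prob_space_distr) (rule \<Theta>_meas)

text \<open>For b > 0, \<open>q_plus_less_1\<close> gives x < 1 and \<open>b_over_le\<close>
  applies. For b = 0 the point x may be 1, but 0 times top is 0 in [0,infinity], so both sides of
  the last claim vanish.\<close>

lemma mean_odds_bound:
  assumes "\<theta> \<in> S" "0 \<le> \<beta>" "\<beta> < 1" "0 \<le> x" "x \<le> q_plus \<kappa> \<beta> \<theta>"
  shows "0 \<le> b_fun \<kappa> \<theta> * (x / (1 - x))"
    and "b_fun \<kappa> \<theta> * (x / (1 - x)) \<le> 1 / (1 - \<beta>)"
    and "ennreal (b_fun \<kappa> \<theta>) * odds (x) = ennreal (b_fun \<kappa> \<theta> * (x / (1 - x)))"
proof -
  consider "b_fun \<kappa> \<theta> = 0" | "0 < b_fun \<kappa> \<theta>" using b_nonneg[OF assms(1)] by fastforce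
  then have "0 \<le> b_fun \<kappa> \<theta> * (x / (1 - x)) \<and> b_fun \<kappa> \<theta> * (x / (1 - x)) \<le> 1 / (1 - \<beta>)
    \<and> ennreal (b_fun \<kappa> \<theta>) * odds (x) = ennreal (b_fun \<kappa> \<theta> * (x / (1 - x)))"
  proof cases
    case 2
    then have f1: "x < 1" using q_plus_less_1[OF assms(1) 2 assms(2,3)] assms(5) by linarith
    moreover have "b_fun \<kappa> \<theta> * (x / (1 - x)) \<le> 1 / (1 - \<beta>)"
      using assms f1 by (intro b_over_le)
    ultimately show ?thesis using 2 assms by (simp add: odds_def ennreal_mult[symmetric])
  qed (use assms in simp)
  then show "0 \<le> b_fun \<kappa> \<theta> * (x / (1 - x))" "b_fun \<kappa> \<theta> * (x / (1 - x)) \<le> 1 / (1 - \<beta>)"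
    "ennreal (b_fun \<kappa> \<theta>) * odds (x) = ennreal (b_fun \<kappa> \<theta> * (x / (1 - x)))" by auto
qed

lemma nn_mean_odds_eq:
  assumes [measurable]: "f \<in> borel_measurable S_borel" and \<beta>: "0 \<le> \<beta>" "\<beta> < 1"
    and f: "\<And>\<theta>. \<theta> \<in> S \<Longrightarrow> 0 \<le> f \<theta>" "\<And>\<theta>. \<theta> \<in> S \<Longrightarrow> f \<theta> \<le> q_plus \<kappa> \<beta> \<theta>"
  shows "nn_mean_odds f = ennreal (mean_odds f)" and "0 \<le> mean_odds f"
proof -
  interpret N: prob_space law by (rule prob_law)
  have "nn_mean_odds f = (\<integral>\<^sup>+\<theta>. ennreal (b_fun \<kappa> \<theta> * (f \<theta> / (1 - f \<theta>))) \<partial>law)"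
    unfolding nn_mean_odds_def using f \<beta> by (intro nn_integral_cong mean_odds_bound) (auto simp: space_S_borel)
  also have "\<dots> = ennreal (mean_odds f)"
    unfolding mean_odds_def
  proof (rule nn_integral_eq_integral)
    show "integrable law (\<lambda>\<theta>. b_fun \<kappa> \<theta> * (f \<theta> / (1 - f \<theta>)))"
    proof (rule N.integrable_const_bound)
      show "AE \<theta> in law. norm (b_fun \<kappa> \<theta> * (f \<theta> / (1 - f \<theta>))) \<le> 1 / (1 - \<beta>)"
      proof (rule AE_I2)
        fix \<theta> assume "\<theta> \<in> space law"
        then have \<theta>: "\<theta> \<in> S" by (simp add: space_S_borel)
        show "norm (b_fun \<kappa> \<theta> * (f \<theta> / (1 - f \<theta>))) \<le> 1 / (1 - \<beta>)"
          using mean_odds_bound[OF \<theta> \<beta> f[OF \<theta>]] by (simp only: real_norm_def abs_of_nonneg)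
      qed
    qed measurable
    show "AE \<theta> in law. 0 \<le> b_fun \<kappa> \<theta> * (f \<theta> / (1 - f \<theta>))"
      using mean_odds_bound(1) \<beta> f by (intro AE_I2) (auto simp: space_S_borel)
  qed
  finally show "nn_mean_odds f = ennreal (mean_odds f)" .
  show "0 \<le> mean_odds f"
    unfolding mean_odds_def using mean_odds_bound(1) \<beta> f
    by (intro Bochner_Integration.integral_nonneg_AE AE_I2) (auto simp: space_S_borel)
qed

text \<open>One level \<beta> < 1 for all n supplies one dominating constant. It also keeps the
  limit below 1 where b > 0, so that x/(1-x) is continuous there.\<close>

lemma mean_odds_tendsto:
  assumes [measurable]: "\<And>n. f n \<in> borel_measurable S_borel" "f' \<in> borel_measurable S_borel"
    and \<beta>: "0 \<le> \<beta>" "\<beta> < 1"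
    and f: "\<And>n \<theta>. \<theta> \<in> S \<Longrightarrow> 0 \<le> f n \<theta>" "\<And>n \<theta>. \<theta> \<in> S \<Longrightarrow> f n \<theta> \<le> q_plus \<kappa> \<beta> \<theta>"
    and lim: "\<And>\<theta>. \<theta> \<in> S \<Longrightarrow> (\<lambda>n. f n \<theta>) \<longlonglongrightarrow> f' \<theta>"
  shows "(\<lambda>n. mean_odds (f n)) \<longlonglongrightarrow> mean_odds f'"
  unfolding mean_odds_def
proof (rule integral_dominated_convergence[where w = "\<lambda>_. 1 / (1 - \<beta>)"])
  interpret N: prob_space law by (rule prob_law)
  show "integrable law (\<lambda>_. 1 / (1 - \<beta>))" by simp
  show "AE \<theta> in law. norm (b_fun \<kappa> \<theta> * (f n \<theta> / (1 - f n \<theta>))) \<le> 1 / (1 - \<beta>)" for n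
  proof (rule AE_I2)
    fix \<theta> assume "\<theta> \<in> space law"
    then have \<theta>: "\<theta> \<in> S" by (simp add: space_S_borel)
    show "norm (b_fun \<kappa> \<theta> * (f n \<theta> / (1 - f n \<theta>))) \<le> 1 / (1 - \<beta>)"
      using mean_odds_bound[OF \<theta> \<beta> f[OF \<theta>, of n]] by (simp only: real_norm_def abs_of_nonneg)
  qed
  show "AE \<theta> in law. (\<lambda>n. b_fun \<kappa> \<theta> * (f n \<theta> / (1 - f n \<theta>))) \<longlonglongrightarrow> b_fun \<kappa> \<theta> * (f' \<theta> / (1 - f' \<theta>))"
  proof (rule AE_I2)
    fix \<theta> assume "\<theta> \<in> space law"
    then have \<theta>: "\<theta> \<in> S" by (simp add: space_S_borel)
    show "(\<lambda>n. b_fun \<kappa> \<theta> * (f n \<theta> / (1 - f n \<theta>))) \<longlonglongrightarrow> b_fun \<kappa> \<theta> * (f' \<theta> / (1 - f' \<theta>))"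
    proof (cases "b_fun \<kappa> \<theta> = 0")
      case False
      then have "q_plus \<kappa> \<beta> \<theta> < 1" using b_nonneg[OF \<theta>] \<beta> \<theta> by (intro q_plus_less_1) auto
      moreover have "f' \<theta> \<le> q_plus \<kappa> \<beta> \<theta>"
        by (rule LIMSEQ_le_const2[OF lim[OF \<theta>]]) (use f \<theta> in auto)
      ultimately show ?thesis by (intro tendsto_intros lim \<theta>) auto
    qed simp
  qed
qed measurable

lemma C_g_one: "C_fun M U \<Theta> (g_one \<kappa>) = nn_mean_odds (q_fun \<kappa> 1)"
proof -
  note q_measurable[of 1, measurable]
  have "e2ennreal \<bar>g_one \<kappa> \<theta>\<bar> = odds (q_fun \<kappa> 1 \<theta>)" for \<theta>
    using q_bounds[of 1 \<theta>] by (simp add: g_one_def odds_def)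
  then show ?thesis
    using nn_expectation_weighted[of "\<lambda>\<theta>. odds (q_fun \<kappa> 1 \<theta>)"] by (simp add: C_fun_def nn_mean_odds_def)
qed

lemma C_real:
  assumes [measurable]: "g \<in> borel_measurable S_borel" and g: "\<forall>\<theta>\<in>S. 0 \<le> g \<theta>"
  shows "C_fun M U \<Theta> (\<lambda>\<theta>. ereal (g \<theta>)) = (\<integral>\<^sup>+\<theta>. ennreal (b_fun \<kappa> \<theta>) * ennreal (g \<theta>) \<partial>law)"
proof -
  have "C_fun M U \<Theta> (\<lambda>\<theta>. ereal (g \<theta>)) = (\<integral>\<^sup>+\<omega>. ennreal (1 - U \<omega>) * ennreal (g (\<Theta> \<omega>)) \<partial>M)"
    unfolding C_fun_def using g \<Theta>_in by (intro nn_integral_cong) simp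
  also have "\<dots> = (\<integral>\<^sup>+\<theta>. ennreal (b_fun \<kappa> \<theta>) * ennreal (g \<theta>) \<partial>law)"
    by (rule nn_expectation_weighted) simp
  finally show ?thesis .
qed

lemma q_mix_measurable:
  assumes "0 \<le> \<alpha>" "\<alpha> < 1" shows "q_mix \<kappa> \<alpha> l \<in> borel_measurable S_borel"
proof -
  have [measurable]: "q_fun \<kappa> \<alpha> \<in> borel_measurable S_borel" "q_plus \<kappa> \<alpha> \<in> borel_measurable S_borel"
    using assms q_measurable q_plus_measurable by auto
  show ?thesis unfolding q_mix_def by measurable
qed

text \<open>At l = 0 and l = 1 the mixed quantile is q_\<alpha> and q_{\<alpha>+}, that is, the
  value and the right limit of the quantiles at the level \<alpha>; the task is to place c between
  their means.\<close>

lemma exists_level: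
  assumes c: "0 \<le> c" "ennreal c < nn_mean_odds (q_fun \<kappa> 1)"
  obtains \<alpha> l where "0 \<le> \<alpha>" "\<alpha> < 1" "0 \<le> l" "l \<le> 1" "mean_odds (q_mix \<kappa> \<alpha> l) = c"
proof -
  define A where "A = {\<alpha> \<in> {0..1}. nn_mean_odds (q_fun \<kappa> \<alpha>) \<le> ennreal c}"
  define \<alpha> where "\<alpha> = Sup A"
  have "nn_mean_odds (q_fun \<kappa> 0) = (\<integral>\<^sup>+\<theta>. 0 \<partial>law)"
    unfolding nn_mean_odds_def by (intro nn_integral_cong) (simp add: q_zero odds_def space_S_borel)
  then have A0: "0 \<in> A" by (simp add: A_def)
  have bdd: "bdd_above A" by (rule bdd_aboveI[of _ 1]) (simp add: A_def)
  have "\<alpha> \<in> closure A" unfolding \<alpha>_def using A0 bdd by (intro closure_contains_Sup) auto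
  then obtain a where a: "\<And>n. a n \<in> A" "a \<longlonglongrightarrow> \<alpha>" unfolding closure_sequential by blast
  have a_le: "a n \<le> \<alpha>" "a n \<le> 1" "0 \<le> a n" for n
    using a(1)[of n] cSup_upper[OF a(1) bdd, of n] by (simp_all add: \<alpha>_def A_def)
  have \<alpha>01: "0 \<le> \<alpha>" "\<alpha> \<le> 1"
  proof -
    show "0 \<le> \<alpha>" unfolding \<alpha>_def using A0 bdd by (rule cSup_upper)
    show "\<alpha> \<le> 1" unfolding \<alpha>_def by (rule cSup_least) (use A0 in blast, simp add: A_def)
  qed
  \<comment> \<open>Fatou instead of dominated convergence: \<alpha> = 1 is not yet excluded, and
    there neither a uniform bound nor a finite limit is at hand. Only the inequality with c has to
    survive.\<close>
  have below: "nn_mean_odds (q_fun \<kappa> \<alpha>) \<le> ennreal c"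
  proof -
    have "nn_mean_odds (q_fun \<kappa> \<alpha>) = (\<integral>\<^sup>+\<theta>. liminf (\<lambda>n. ennreal (b_fun \<kappa> \<theta>) * odds (q_fun \<kappa> (a n) \<theta>)) \<partial>law)"
      unfolding nn_mean_odds_def
    proof (rule nn_integral_cong)
      fix \<theta> assume "\<theta> \<in> space law"
      then have \<theta>: "\<theta> \<in> S" by (simp add: space_S_borel)
      have "(\<lambda>n. odds (q_fun \<kappa> (a n) \<theta>)) \<longlonglongrightarrow> odds (q_fun \<kappa> \<alpha> \<theta>)"
        by (rule odds_tendsto[OF q_bounds(2)[OF a_le(2)] q_bounds(2)[OF \<alpha>01(2)] q_tendsto_left[OF \<theta> \<alpha>01(2) a_le(1) a(2)]])
      then have "(\<lambda>n. ennreal (b_fun \<kappa> \<theta>) * odds (q_fun \<kappa> (a n) \<theta>)) \<longlonglongrightarrow> ennreal (b_fun \<kappa> \<theta>) * odds (q_fun \<kappa> \<alpha> \<theta>)"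
        by (intro ennreal_tendsto_cmult) simp_all
      then show "ennreal (b_fun \<kappa> \<theta>) * odds (q_fun \<kappa> \<alpha> \<theta>) = liminf (\<lambda>n. ennreal (b_fun \<kappa> \<theta>) * odds (q_fun \<kappa> (a n) \<theta>))"
        by (rule lim_imp_Liminf[OF trivial_limit_sequentially, symmetric])
    qed
    also have "\<dots> \<le> liminf (\<lambda>n. nn_mean_odds (q_fun \<kappa> (a n)))"
      unfolding nn_mean_odds_def
    proof (rule nn_integral_liminf)
      fix n
      have [measurable]: "q_fun \<kappa> (a n) \<in> borel_measurable S_borel" using a_le by (intro q_measurable)
      show "(\<lambda>\<theta>. ennreal (b_fun \<kappa> \<theta>) * odds (q_fun \<kappa> (a n) \<theta>)) \<in> borel_measurable law" by simp
    qed
    also have "\<dots> \<le> ennreal c"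
      using a(1) by (intro Liminf_le) (auto simp: A_def)
    finally show ?thesis .
  qed
  \<comment> \<open>At level 1 the mean exceeds c, so the supremum stays below 1 and domination
    becomes available.\<close>
  then have "\<alpha> \<noteq> 1" using c(2) by (auto simp: not_le[symmetric])
  then have \<alpha>1: "\<alpha> < 1" using \<alpha>01(2) by simp
  have qm: "q_fun \<kappa> \<alpha> \<in> borel_measurable S_borel" "q_plus \<kappa> \<alpha> \<in> borel_measurable S_borel"
    by (rule q_measurable[OF \<alpha>01(2)], rule q_plus_measurable[OF \<alpha>01(1) \<alpha>1])
  have lower: "mean_odds (q_fun \<kappa> \<alpha>) \<le> c"
    using below c(1) nn_mean_odds_eq(1)[OF qm(1) \<alpha>01(1) \<alpha>1 q_bounds(1)[OF \<alpha>01(2)] q_le_q_plus[OF _ \<alpha>1]]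
    by (simp only: ennreal_le_iff)
  have upper: "c \<le> mean_odds (q_plus \<kappa> \<alpha>)"
  proof -
    \<comment> \<open>The midpoint of \<alpha> and 1, equal to \<open>d 0\<close>. All
      \<open>d n\<close> stay at or below it, which gives a uniform bound along the
      sequence.\<close>
    define \<beta> where "\<beta> = (\<alpha> + 1) / 2"
    define d where "d n = \<alpha> + ((1 - \<alpha>) / 2) / real (Suc n)" for n
    have \<beta>: "0 \<le> \<beta>" "\<beta> < 1" using \<alpha>01 \<alpha>1 by (auto simp: \<beta>_def)
    have "d \<longlonglongrightarrow> \<alpha> + 0" unfolding d_def by (intro tendsto_intros LIMSEQ_Suc lim_const_over_n)
    then have d_lim: "d \<longlonglongrightarrow> \<alpha>" by simp
    have d: "\<alpha> < d n" "d n \<le> \<beta>" for n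
    proof -
      show "\<alpha> < d n" using \<alpha>1 by (simp add: d_def)
      have "((1 - \<alpha>) / 2) / real (Suc n) \<le> ((1 - \<alpha>) / 2) / 1"
        using \<alpha>1 by (intro divide_left_mono) auto
      then show "d n \<le> \<beta>" by (simp add: d_def \<beta>_def diff_divide_distrib add_divide_distrib)
    qed
    have d1: "d n \<le> 1" for n using d(2)[of n] \<beta> by simp
    have d_le: "q_fun \<kappa> (d n) \<theta> \<le> q_plus \<kappa> \<beta> \<theta>" if "\<theta> \<in> S" for n \<theta>
      using q_mono[OF that d(2)[of n]] q_le_q_plus[OF that \<beta>(2)] \<beta>(2) by linarith
    have "(\<lambda>n. mean_odds (q_fun \<kappa> (d n))) \<longlonglongrightarrow> mean_odds (q_plus \<kappa> \<alpha>)"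
      by (rule mean_odds_tendsto[OF q_measurable[OF d1] qm(2) \<beta> q_bounds(1)[OF d1] d_le q_tendsto_right[OF _ \<alpha>01(1) d(1) d1 d_lim]])
    moreover have "c \<le> mean_odds (q_fun \<kappa> (d n))" for n
    proof -
      have "d n \<notin> A" using d(1)[of n] cSup_upper[OF _ bdd, of "d n"] by (auto simp: \<alpha>_def)
      then have "ennreal c < nn_mean_odds (q_fun \<kappa> (d n))" using d(1)[of n] d1[of n] \<alpha>01 by (simp add: A_def not_le)
      also have "\<dots> = ennreal (mean_odds (q_fun \<kappa> (d n)))"
        by (rule nn_mean_odds_eq[OF q_measurable[OF d1] \<beta> q_bounds(1)[OF d1] d_le])
      finally show ?thesis using c by (simp add: ennreal_less_iff)
    qed
    ultimately show ?thesis by (intro LIMSEQ_le_const) auto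
  qed
  have cont: "continuous_on {0..1} (\<lambda>l. mean_odds (q_mix \<kappa> \<alpha> l))"
    unfolding continuous_on_sequentially o_def
  proof (intro ballI allI impI, elim conjE)
    fix l and s :: "nat \<Rightarrow> real"
    assume l: "l \<in> {0..1}" and s: "\<forall>n. s n \<in> {0..1}" "s \<longlonglongrightarrow> l"
    show "(\<lambda>n. mean_odds (q_mix \<kappa> \<alpha> (s n))) \<longlonglongrightarrow> mean_odds (q_mix \<kappa> \<alpha> l)"
    proof (rule mean_odds_tendsto[OF q_mix_measurable[OF \<alpha>01(1) \<alpha>1] q_mix_measurable[OF \<alpha>01(1) \<alpha>1] \<alpha>01(1) \<alpha>1])
      fix n \<theta> assume \<theta>: "\<theta> \<in> S"
      show "0 \<le> q_mix \<kappa> \<alpha> (s n) \<theta>"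
        using q_mix_bounds(1)[OF \<theta> \<alpha>1, of "s n"] q_bounds(1)[OF \<alpha>01(2), of \<theta>] s(1) by fastforce
      show "q_mix \<kappa> \<alpha> (s n) \<theta> \<le> q_plus \<kappa> \<alpha> \<theta>"
        using q_mix_bounds(2)[OF \<theta> \<alpha>1, of "s n"] s(1) by auto
      show "(\<lambda>n. q_mix \<kappa> \<alpha> (s n) \<theta>) \<longlonglongrightarrow> q_mix \<kappa> \<alpha> l \<theta>"
        unfolding q_mix_def by (intro tendsto_intros s)
    qed
  qed
  have "mean_odds (q_mix \<kappa> \<alpha> 0) \<le> c" "c \<le> mean_odds (q_mix \<kappa> \<alpha> 1)"
    using lower upper by (simp_all add: q_mix_def[abs_def])
  then obtain l where "0 \<le> l" "l \<le> 1" "mean_odds (q_mix \<kappa> \<alpha> l) = c"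
    using IVT'[of "\<lambda>l. mean_odds (q_mix \<kappa> \<alpha> l)" 0 c 1] cont by auto
  then show ?thesis using that \<alpha>01 \<alpha>1 by blast
qed

subsection \<open>The three cases\<close>

lemma interior_case:
  assumes EU: "0 < expectation U" and C: "ennreal (expectation U) < C_fun M U \<Theta> (g_one \<kappa>)"
  shows "\<exists>\<alpha>\<in>{0..<1}. \<exists>l\<in>{0..1}. C_fun M U \<Theta> (\<lambda>\<theta>. ereal (g_mix \<kappa> \<alpha> l \<theta>)) = ennreal (expectation U)
    \<and> is_solution M U \<Theta> S (g_mix \<kappa> \<alpha> l)"
proof -
  obtain \<alpha> l where \<alpha>: "0 \<le> \<alpha>" "\<alpha> < 1" and l: "0 \<le> l" "l \<le> 1" and level: "mean_odds (q_mix \<kappa> \<alpha> l) = expectation U"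
    using exists_level[of "expectation U"] EU C by (auto simp: C_g_one)
  let ?g = "g_mix \<kappa> \<alpha> l" and ?q = "q_mix \<kappa> \<alpha> l"
  have qm [measurable]: "?q \<in> borel_measurable S_borel" by (rule q_mix_measurable[OF \<alpha>])
  have q0: "0 \<le> ?q \<theta>" and q1: "?q \<theta> \<le> q_plus \<kappa> \<alpha> \<theta>" if "\<theta> \<in> S" for \<theta>
    using q_mix_bounds[OF that \<alpha>(2) l] q_bounds(1)[of \<alpha> \<theta>] \<alpha> by auto
  have gm [measurable]: "?g \<in> borel_measurable S_borel"
    unfolding g_mix_def[abs_def] by measurable
  have g0: "\<forall>\<theta>\<in>S. 0 \<le> ?g \<theta>"
  proof
    fix \<theta> assume "\<theta> \<in> S"
    then show "0 \<le> ?g \<theta>"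
      using q0[of \<theta>] q1[of \<theta>] q_plus_bounds(2)[OF \<alpha>(2), of \<theta>] by (simp add: g_mix_def)
  qed
  have "(\<integral>\<^sup>+\<theta>. ennreal (b_fun \<kappa> \<theta>) * ennreal (?g \<theta>) \<partial>law) = nn_mean_odds ?q"
    unfolding nn_mean_odds_def
  proof (rule nn_integral_cong)
    fix \<theta> assume "\<theta> \<in> space law"
    then have \<theta>: "\<theta> \<in> S" by (simp add: space_S_borel)
    show "ennreal (b_fun \<kappa> \<theta>) * ennreal (?g \<theta>) = ennreal (b_fun \<kappa> \<theta>) * odds (?q \<theta>)"
      unfolding mean_odds_bound(3)[OF \<theta> \<alpha> q0[OF \<theta>] q1[OF \<theta>]] g_mix_def
      by (rule ennreal_mult'[symmetric]) (rule b_nonneg[OF \<theta>])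
  qed
  also have "\<dots> = ennreal (expectation U)"
    using nn_mean_odds_eq(1)[OF qm \<alpha> q0 q1] level by simp
  finally have int: "(\<integral>\<^sup>+\<theta>. ennreal (b_fun \<kappa> \<theta>) * ennreal (?g \<theta>) \<partial>law) = ennreal (expectation U)" .
  then have feas: "?g \<in> feasible M U \<Theta> S (expectation U)"
    using gm g0 by (simp add: feasible_iff)
  have "is_solution M U \<Theta> S ?g"
    unfolding is_solution_def Lambda_def
  proof (intro conjI ballI mult_left_mono feas)
    fix g' assume "g' \<in> feasible M U \<Theta> S (expectation U)"
    then show "(\<integral>\<omega>. min (U \<omega>) ((1 - U \<omega>) * g' (\<Theta> \<omega>)) \<partial>M) \<le> (\<integral>\<omega>. min (U \<omega>) ((1 - U \<omega>) * ?g (\<Theta> \<omega>)) \<partial>M)"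
    proof (rule lagrange_sufficient[OF feas, of _ "1 - \<alpha>"])
      fix \<theta> and y :: real assume \<theta>: "\<theta> \<in> S" and y: "0 \<le> y"
      show "(\<integral>u. min u ((1 - u) * y) \<partial>\<kappa> \<theta>) + (1 - \<alpha>) * b_fun \<kappa> \<theta> * ?g \<theta>
          \<le> (\<integral>u. min u ((1 - u) * ?g \<theta>) \<partial>\<kappa> \<theta>) + (1 - \<alpha>) * b_fun \<kappa> \<theta> * y"
      proof (cases "b_fun \<kappa> \<theta> = 0")
        case True
        \<comment> \<open>For b = 0 the conditional law is concentrated at u = 1, where the reward
          is 0 for every g, so the possibly degenerate quotient in \<open>g_mix\<close> does no
          harm.\<close>
        have "integrable (\<kappa> \<theta>) (\<lambda>u. 1 - u)" by (rule integrable_kernel[OF \<theta>, of _ 1]) auto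
        moreover have "AE u in \<kappa> \<theta>. 0 \<le> 1 - u" by (rule AE_I2) (simp add: space_kernel[OF \<theta>])
        ultimately have "AE u in \<kappa> \<theta>. 1 - u = 0"
          using True integral_nonneg_eq_0_iff_AE[of "\<kappa> \<theta>" "\<lambda>u. 1 - u"] unfolding b_fun_def by blast
        then have "(\<integral>u. min u ((1 - u) * y) \<partial>\<kappa> \<theta>) = (\<integral>u. min u ((1 - u) * ?g \<theta>) \<partial>\<kappa> \<theta>)"
          by (intro integral_cong_AE measurable_kernel[OF \<theta>]) auto
        then show ?thesis using True by simp
      next
        case False
        then have "?q \<theta> < 1"
          using q1[OF \<theta>] q_plus_less_1[OF \<theta> _ \<alpha>] b_nonneg[OF \<theta>] by fastforce
        then show ?thesis
          unfolding g_mix_def using q_mix_bounds[OF \<theta> \<alpha>(2) l] \<theta> \<alpha> y by (intro lagrange_kernel)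
      qed
    qed (use EU \<alpha> in auto)
  qed (use EU in auto)
  moreover have "C_fun M U \<Theta> (\<lambda>\<theta>. ereal (?g \<theta>)) = ennreal (expectation U)"
    using C_real[OF gm g0] int by simp
  ultimately show ?thesis using \<alpha> l by (intro bexI[of _ \<alpha>] bexI[of _ l]) simp_all
qed

text \<open>At level 1 \<open>tail_le\<close> leaves no weighted mass beyond q_1, and
  E[(1-U); b(Theta) = 0] vanishes as well. Both integrands carry the factor 1-U, which is positive
  where U < 1, so both become almost sure statements on that event.\<close>

lemma U_le_q_one: "AE \<omega> in M. U \<omega> < 1 \<longrightarrow> U \<omega> \<le> q_fun \<kappa> 1 (\<Theta> \<omega>) \<and> 0 < b_fun \<kappa> (\<Theta> \<omega>)"
proof -
  note fst_measurable [measurable] q_measurable[of 1, measurable] \<Theta>_meas [measurable]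
  let ?f = "\<lambda>u \<theta>. ennreal ((1 - u) * indicator {q_fun \<kappa> 1 \<theta><..} u)"
  have "(\<integral>\<^sup>+\<omega>. ?f (U \<omega>) (\<Theta> \<omega>) \<partial>M) = (\<integral>\<^sup>+\<omega>. (\<lambda>x. ?f (fst x) (snd x)) (U \<omega>, \<Theta> \<omega>) \<partial>M)" by simp
  also have "\<dots> = (\<integral>\<^sup>+\<theta>. \<integral>\<^sup>+u. ?f u \<theta> \<partial>\<kappa> \<theta> \<partial>law)"
    by (subst disintegration) (simp_all add: indicator_def)
  also have "\<dots> = (\<integral>\<^sup>+\<theta>. 0 \<partial>law)"
  proof (rule nn_integral_cong)
    fix \<theta> assume "\<theta> \<in> space law"
    then have \<theta>: "\<theta> \<in> S" by (simp add: space_S_borel)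
    have "(\<integral>\<^sup>+u. ?f u \<theta> \<partial>\<kappa> \<theta>) = ennreal (\<integral>u. (1 - u) * indicator {q_fun \<kappa> 1 \<theta><..} u \<partial>\<kappa> \<theta>)"
      by (rule nn_integral_kernel[OF \<theta>]) (auto simp: indicator_def)
    also have "\<dots> = 0" using tail_le[OF \<theta>, of 1] by (simp add: ennreal_eq_0_iff)
    finally show "(\<integral>\<^sup>+u. ?f u \<theta> \<partial>\<kappa> \<theta>) = 0" .
  qed
  finally have "(\<integral>\<^sup>+\<omega>. ?f (U \<omega>) (\<Theta> \<omega>) \<partial>M) = 0" by simp
  then have 1: "AE \<omega> in M. ?f (U \<omega>) (\<Theta> \<omega>) = 0"
    by (subst (asm) nn_integral_0_iff_AE) (auto simp: indicator_def)
  have "(\<integral>\<^sup>+\<omega>. ennreal (1 - U \<omega>) * indicator {\<theta> \<in> space S_borel. b_fun \<kappa> \<theta> = 0} (\<Theta> \<omega>) \<partial>M)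
      = (\<integral>\<^sup>+\<theta>. ennreal (b_fun \<kappa> \<theta>) * indicator {\<theta> \<in> space S_borel. b_fun \<kappa> \<theta> = 0} \<theta> \<partial>law)"
    by (rule nn_expectation_weighted) simp
  also have "\<dots> = (\<integral>\<^sup>+\<theta>. 0 \<partial>law)" by (rule nn_integral_cong) (auto simp: indicator_def)
  finally have "(\<integral>\<^sup>+\<omega>. ennreal (1 - U \<omega>) * indicator {\<theta> \<in> space S_borel. b_fun \<kappa> \<theta> = 0} (\<Theta> \<omega>) \<partial>M) = 0"
    by simp
  then have 2: "AE \<omega> in M. ennreal (1 - U \<omega>) * indicator {\<theta> \<in> space S_borel. b_fun \<kappa> \<theta> = 0} (\<Theta> \<omega>) = 0"
    by (subst (asm) nn_integral_0_iff_AE) auto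
  show ?thesis
    using 1 2 AE_space
  proof eventually_elim
    case (elim \<omega>)
    then show ?case
      using b_nonneg[OF \<Theta>_in[of \<omega>]] \<Theta>_in[of \<omega>]
      by (cases "q_fun \<kappa> 1 (\<Theta> \<omega>) < U \<omega>") (auto simp: indicator_def ennreal_eq_0_iff space_S_borel split: if_splits)
  qed
qed

text \<open>g_1 saturates by \<open>U_le_q_one\<close>, and c >= 1 because C(g_1) <= E[U]; scaling
  by c thus preserves saturation while filling the constraint. Finiteness of C(g_1) confines the
  value infinity of g_1 to b = 0 up to null sets, and the first claim records that passing to reals
  changes nothing elsewhere.\<close>

lemma boundary_case:
  assumes EU: "0 < expectation U" and C: "C_fun M U \<Theta> (g_one \<kappa>) \<le> ennreal (expectation U)"
    and C0: "C_fun M U \<Theta> (g_one \<kappa>) \<noteq> 0"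
    and c: "c = expectation U / enn2real (C_fun M U \<Theta> (g_one \<kappa>))"
    and g: "g = (\<lambda>\<theta>. c * real_of_ereal (g_one \<kappa> \<theta>))"
  shows "AE \<theta> in law. 0 < b_fun \<kappa> \<theta> \<longrightarrow> ereal (g \<theta>) = ereal c * g_one \<kappa> \<theta>"
    and "is_solution M U \<Theta> S g"
    and "Lambda M U \<Theta> g = (\<integral>\<omega>. U \<omega> * indicator {..<1} (U \<omega>) \<partial>M) / expectation U"
proof -
  note q_measurable[of 1, measurable]
  let ?q = "q_fun \<kappa> 1"
  \<comment> \<open>C(g_1) = 0 would force U into {0,1} almost surely; with \<open>C0\<close> the
    denominator of c is a positive real.\<close>
  obtain r where r: "0 < r" "r \<le> expectation U" "C_fun M U \<Theta> (g_one \<kappa>) = ennreal r"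
    using C C0 EU by (cases "C_fun M U \<Theta> (g_one \<kappa>)") (auto simp: top_unique order.strict_iff_order)
  have c1: "1 \<le> c" and cr: "c * r = expectation U" using r by (auto simp: c)
  have nn_mean_odds: "nn_mean_odds ?q = ennreal r" using r by (simp add: C_g_one)
  have "AE \<theta> in law. ennreal (b_fun \<kappa> \<theta>) * odds (?q \<theta>) \<noteq> \<infinity>"
    using nn_mean_odds by (intro nn_integral_PInf_AE) (auto simp: nn_mean_odds_def)
  then have q_law: "AE \<theta> in law. 0 < b_fun \<kappa> \<theta> \<longrightarrow> ?q \<theta> \<noteq> 1"
    by eventually_elim (auto simp: odds_def ennreal_mult_top)
  show "AE \<theta> in law. 0 < b_fun \<kappa> \<theta> \<longrightarrow> ereal (g \<theta>) = ereal c * g_one \<kappa> \<theta>"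
    using q_law by eventually_elim (auto simp: g g_one_def)
  \<comment> \<open>No exception at q = 1: \<open>real_of_ereal\<close> sends infinity to 0, and 1 /
    0 is 0 as well.\<close>
  have g_eq: "g \<theta> = c * (?q \<theta> / (1 - ?q \<theta>))" for \<theta>
    by (simp add: g g_one_def)
  have gm [measurable]: "g \<in> borel_measurable S_borel"
    unfolding g_eq[abs_def] by measurable
  have g0: "\<forall>\<theta>\<in>S. 0 \<le> g \<theta>"
    unfolding g_eq using c1 q_bounds[of 1] by simp
  have "(\<integral>\<^sup>+\<theta>. ennreal (b_fun \<kappa> \<theta>) * ennreal (g \<theta>) \<partial>law)
      = (\<integral>\<^sup>+\<theta>. ennreal c * (ennreal (b_fun \<kappa> \<theta>) * odds (?q \<theta>)) \<partial>law)"
  proof (rule nn_integral_cong_AE)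
    show "AE \<theta> in law. ennreal (b_fun \<kappa> \<theta>) * ennreal (g \<theta>) = ennreal c * (ennreal (b_fun \<kappa> \<theta>) * odds (?q \<theta>))"
      using q_law AE_space
    proof eventually_elim
      case (elim \<theta>)
      then have b: "0 \<le> b_fun \<kappa> \<theta>" by (intro b_nonneg) (simp add: space_S_borel)
      show ?case
      proof (cases "b_fun \<kappa> \<theta> = 0")
        case False
        then have "odds (?q \<theta>) = ennreal (?q \<theta> / (1 - ?q \<theta>))" using elim b by (simp add: odds_def)
        moreover have "ennreal (g \<theta>) = ennreal c * ennreal (?q \<theta> / (1 - ?q \<theta>))"
          unfolding g_eq using c1 by (intro ennreal_mult') simp
        ultimately show ?thesis by (simp add: mult.left_commute)
      qed simp
    qed
  qed
  also have "\<dots> = ennreal c * ennreal r"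
    using nn_mean_odds by (subst nn_integral_cmult) (simp_all add: nn_mean_odds_def)
  also have "\<dots> = ennreal (expectation U)" using r c1 cr by (simp add: ennreal_mult[symmetric])
  finally have feas: "g \<in> feasible M U \<Theta> S (expectation U)"
    using gm g0 by (simp add: feasible_iff)
  have sat: "AE \<omega> in M. U \<omega> < 1 \<longrightarrow> U \<omega> \<le> (1 - U \<omega>) * g (\<Theta> \<omega>)"
    using U_le_q_one AE_distrD[OF \<Theta>_meas q_law] AE_space
  proof eventually_elim
    case (elim \<omega>)
    show ?case
    proof
      assume u: "U \<omega> < 1"
      let ?p = "?q (\<Theta> \<omega>)"
      have p: "U \<omega> \<le> ?p" "?p < 1" "0 \<le> ?p"
        using elim u q_bounds[of 1 "\<Theta> \<omega>"] by (auto simp: less_le)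
      then have "U \<omega> / (1 - U \<omega>) \<le> ?p / (1 - ?p)" using u by (simp add: field_simps)
      also have "\<dots> \<le> g (\<Theta> \<omega>)" unfolding g_eq using p c1 by (intro mult_right_mono[of 1 c, simplified]) auto
      finally show "U \<omega> \<le> (1 - U \<omega>) * g (\<Theta> \<omega>)" using u by (simp add: field_simps)
    qed
  qed
  show "is_solution M U \<Theta> S g"
    "Lambda M U \<Theta> g = (\<integral>\<omega>. U \<omega> * indicator {..<1} (U \<omega>) \<partial>M) / expectation U"
    using saturating_is_solution[OF EU feas sat] by auto
qed

text \<open>The function u/(1-u), cut off at u = 1, saturates with equality on {U < 1} and uses up
  only E of the constraint; the factor E[U]/E >= 1 spends the remainder without losing saturation.
  \<open>E0\<close> excludes that U takes only the values 0 and 1 almost surely.\<close>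

lemma deterministic_case:
  assumes EU: "0 < expectation U" and u: "deterministic_version M U \<Theta> S u"
    and E: "E = (\<integral>\<omega>. U \<omega> * indicator {..<1} (U \<omega>) \<partial>M)" and E0: "E \<noteq> 0"
    and g: "g = (\<lambda>\<theta>. expectation U / E * (u \<theta> / (1 - u \<theta>)) * indicator {..<1} (u \<theta>))"
  shows "is_solution M U \<Theta> S g" and "Lambda M U \<Theta> g = E / expectation U"
proof -
  have um [measurable]: "u \<in> borel_measurable S_borel" and u01: "\<forall>\<theta>\<in>S. u \<theta> \<in> {0..1}"
    and uU: "AE \<omega> in M. U \<omega> = u (\<Theta> \<omega>)"
    using u by (auto simp: deterministic_version_def)
  have Eint: "integrable M (\<lambda>\<omega>. U \<omega> * indicator {..<1} (U \<omega>))"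
    by (rule integrable_const_bound[of _ 1]) (use U_bounds in \<open>auto simp: indicator_def\<close>)
  have "0 \<le> E" unfolding E using U_bounds by (intro Bochner_Integration.integral_nonneg_AE AE_I2) (auto simp: indicator_def)
  then have Epos: "0 < E" using E0 by simp
  have E_le: "E \<le> expectation U" unfolding E truncated_expectation by simp
  have gm [measurable]: "g \<in> borel_measurable S_borel" unfolding g by measurable
  have g0: "\<forall>\<theta>\<in>S. 0 \<le> g \<theta>" unfolding g using EU Epos u01 by (auto simp: indicator_def)
  \<comment> \<open>Cancelling 1-u needs u < 1; at u = 1 the indicator makes both sides 0.\<close>
  have g_val: "(1 - u \<theta>) * g \<theta> = expectation U / E * (u \<theta> * indicator {..<1} (u \<theta>))" if "\<theta> \<in> S" for \<theta>
    using u01 that by (auto simp: g indicator_def)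
  have "(\<integral>\<^sup>+\<omega>. ennreal ((1 - U \<omega>) * g (\<Theta> \<omega>)) \<partial>M)
      = (\<integral>\<^sup>+\<omega>. ennreal (expectation U / E * (U \<omega> * indicator {..<1} (U \<omega>))) \<partial>M)"
  proof (rule nn_integral_cong_AE)
    show "AE \<omega> in M. ennreal ((1 - U \<omega>) * g (\<Theta> \<omega>)) = ennreal (expectation U / E * (U \<omega> * indicator {..<1} (U \<omega>)))"
      using uU AE_space by eventually_elim (simp only: g_val[OF \<Theta>_in])
  qed
  also have "\<dots> = ennreal (\<integral>\<omega>. expectation U / E * (U \<omega> * indicator {..<1} (U \<omega>)) \<partial>M)"
    using Eint EU Epos U_bounds by (intro nn_integral_eq_integral) (auto intro!: AE_I2 simp: indicator_def)
  also have "(\<integral>\<omega>. expectation U / E * (U \<omega> * indicator {..<1} (U \<omega>)) \<partial>M) = expectation U"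
    using Epos by (simp add: E[symmetric])
  finally have feas: "g \<in> feasible M U \<Theta> S (expectation U)"
    using gm g0 by (simp add: feasible_def)
  have sat: "AE \<omega> in M. U \<omega> < 1 \<longrightarrow> U \<omega> \<le> (1 - U \<omega>) * g (\<Theta> \<omega>)"
    using uU AE_space
  proof eventually_elim
    case (elim \<omega>)
    have "1 * U \<omega> \<le> expectation U / E * U \<omega>"
      using E_le Epos U_bounds[OF elim(2)] by (intro mult_right_mono) auto
    then show ?case using g_val[OF \<Theta>_in[OF elim(2)]] elim by (simp add: indicator_def)
  qed
  show "is_solution M U \<Theta> S g" "Lambda M U \<Theta> g = E / expectation U"
    using saturating_is_solution[OF EU feas sat] by (auto simp: E)
qed

end
theorem theorem3p8:
  fixes \<tau> :: "real ^ 'd \<Rightarrow> real"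
    and M :: "'w measure"
    and U :: "'w \<Rightarrow> real"
    and \<Theta> :: "'w \<Rightarrow> real ^ 'd"
    and \<kappa> :: "real ^ 'd \<Rightarrow> real measure"
    and S :: "(real ^ 'd) set"
    and EU EU1 :: real
  assumes \<tau>_cont: "continuous_on UNIV \<tau>"
    and \<tau>_nonneg: "\<And>x. 0 \<le> \<tau> x"
    and \<tau>_hom: "\<And>c x. 0 \<le> c \<Longrightarrow> \<tau> (c *\<^sub>R x) = c * \<tau> x"
    and S: "S = unit_sphere \<tau>"
    and M: "prob_space M"
    and U: "U \<in> M \<rightarrow>\<^sub>M restrict_space borel {0..1}"
    and \<Theta>: "\<Theta> \<in> M \<rightarrow>\<^sub>M restrict_space borel S"
    and \<kappa>: "regular_cond_distr M U (restrict_space borel {0..1}) \<Theta> (restrict_space borel S) \<kappa>"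
    and U_ne_0: "measure M {\<omega> \<in> space M. U \<omega> = 0} < 1"
    and U_ne_1: "measure M {\<omega> \<in> space M. U \<omega> = 1} < 1"
    and EU: "EU = (\<integral>\<omega>. U \<omega> \<partial>M)"
    and EU1: "EU1 = (\<integral>\<omega>. U \<omega> * indicator {..<1} (U \<omega>) \<partial>M)"
  shows
    "(\<forall>u. deterministic_version M U \<Theta> S u \<and> EU1 \<noteq> 0 \<longrightarrow>
        (let g_opt = (\<lambda>\<theta>. EU / EU1 * (u \<theta> / (1 - u \<theta>)) * indicator {..<1} (u \<theta>))
         in is_solution M U \<Theta> S g_opt \<and>
            Lambda M U \<Theta> g_opt = EU1 / EU \<and>
            EU1 / EU = 1 - measure M {\<omega> \<in> space M. U \<omega> = 1} / EU))
     \<and>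
     ((\<nexists>u. deterministic_version M U \<Theta> S u) \<longrightarrow>
        (ennreal EU < C_fun M U \<Theta> (g_one \<kappa>) \<longrightarrow>
           (\<exists>\<alpha>\<in>{0..<1}. \<exists>l\<in>{0..1}.
              C_fun M U \<Theta> (\<lambda>\<theta>. ereal (g_mix \<kappa> \<alpha> l \<theta>)) = ennreal EU \<and>
              is_solution M U \<Theta> S (g_mix \<kappa> \<alpha> l)))
      \<and>
        (C_fun M U \<Theta> (g_one \<kappa>) \<le> ennreal EU \<and> C_fun M U \<Theta> (g_one \<kappa>) \<noteq> 0 \<longrightarrow>
           (let c = EU / enn2real (C_fun M U \<Theta> (g_one \<kappa>));
                g_opt = (\<lambda>\<theta>. c * real_of_ereal (g_one \<kappa> \<theta>))
            in (AE \<theta> in distr M (restrict_space borel S) \<Theta>.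
                  0 < b_fun \<kappa> \<theta> \<longrightarrow> ereal (g_opt \<theta>) = ereal c * g_one \<kappa> \<theta>) \<and>
               is_solution M U \<Theta> S g_opt \<and>
               Lambda M U \<Theta> g_opt = EU1 / EU \<and>
               EU1 / EU = 1 - measure M {\<omega> \<in> space M. U \<omega> = 1} / EU)))"
proof -
  interpret cond_law M U \<Theta> S \<kappa>
    using M U \<Theta> \<kappa> by (simp add: cond_law_def cond_law_axioms_def)
  have pos: "0 < expectation U" by (rule expectation_U_pos[OF U_ne_0])
  have ratio: "EU1 / EU = 1 - measure M {\<omega> \<in> space M. U \<omega> = 1} / EU"
    using pos by (simp add: EU EU1 truncated_expectation diff_divide_distrib)
  show ?thesis
    unfolding Let_def
  proof (intro conjI allI impI ratio)
    fix u assume u: "deterministic_version M U \<Theta> S u \<and> EU1 \<noteq> 0"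
    let ?g = "\<lambda>\<theta>. EU / EU1 * (u \<theta> / (1 - u \<theta>)) * indicator {..<1} (u \<theta>)"
    show "is_solution M U \<Theta> S ?g" "Lambda M U \<Theta> ?g = EU1 / EU"
      using deterministic_case[OF pos conjunct1[OF u] EU1 conjunct2[OF u] refl] unfolding EU by blast+
  next
    assume "ennreal EU < C_fun M U \<Theta> (g_one \<kappa>)"
    then show "\<exists>\<alpha>\<in>{0..<1}. \<exists>l\<in>{0..1}.
              C_fun M U \<Theta> (\<lambda>\<theta>. ereal (g_mix \<kappa> \<alpha> l \<theta>)) = ennreal EU \<and>
              is_solution M U \<Theta> S (g_mix \<kappa> \<alpha> l)"
      unfolding EU by (rule interior_case[OF pos])
  next
    let ?c = "EU / enn2real (C_fun M U \<Theta> (g_one \<kappa>))"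
    let ?g = "\<lambda>\<theta>. ?c * real_of_ereal (g_one \<kappa> \<theta>)"
    assume C: "C_fun M U \<Theta> (g_one \<kappa>) \<le> ennreal EU \<and> C_fun M U \<Theta> (g_one \<kappa>) \<noteq> 0"
    note * = boundary_case[OF pos conjunct1[OF C, unfolded EU] conjunct2[OF C] refl refl, folded EU]
    show "AE \<theta> in distr M (restrict_space borel S) \<Theta>.
        0 < b_fun \<kappa> \<theta> \<longrightarrow> ereal (?g \<theta>) = ereal ?c * g_one \<kappa> \<theta>"
      by (rule *(1))
    show "is_solution M U \<Theta> S ?g" by (rule *(2))
    show "Lambda M U \<Theta> ?g = EU1 / EU" unfolding EU1 by (rule *(3))
  qed
qed

end
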